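(* Suppose $\mathcal Q$ is vertically unbounded and $s_\infty=1$. Then $B=B^{ct}\sqcup B^{unb}$.
   Context: Let $(K,v)$ be a valued field, $\Gamma$ the divisible hull of $vK$, embedded in a divisible ordered abelian group $\Lambda$. Let $\nu\colon K[x]\to\Lambda\cup\{\infty\}$ be a valuation extending $v$ which is well-specified, i.e. it is not the case that simultaneously $\nu^{-1}(\infty)=0$, the value group of $\nu$ modulo $\Gamma$ is torsion, and the residue field of $\nu$ is algebraic over that of $v$. For $s\ge0$ let $\partial_s$ be the $s$-th Hasse–Schmidt derivative, defined by $f(x+y)=\sum_{s\ge0}(\partial_sf)y^s$. For nonconstant $f$ with $\nu(f)<\infty$ the level is $\epsilon_\nu(f)=\max\{(\nu(f)-\nu(\partial_sf))/s: s\ge1\}$ and $I(f)$ is the set of $s\ge1$ attaining the maximum; $\epsilon_\nu(a)=-\infty$ for $a\in K$. A monic $Q\in K[x]$ is a key polynomial for $\nu$ if $\epsilon_\nu(f)<\epsilon_\nu(Q)$ whenever $\deg f<\deg Q$. For monic $Q$, each $f$ has a unique $Q$-expansion $f=\sum_{i\ge0}f_{Q,i}Q^i$ with $\deg f_{Q,i}<\deg Q$; set $\nu_Q(f)=\min_i\nu(f_{Q,i}Q^i)$. Fix $m\ge1$ such that the set $\Psi_m$ of key polynomials of degree $m$ for $\nu$ is nonempty and has no element of maximal $\nu$-value. Let $\mathcal Q\subseteq\Psi_m$ be well-ordered by $Q<R\iff\nu(Q)<\nu(R)$ and cofinal in $\Psi_m$ for $\nu$-values; write $\gamma_Q=\nu(Q)$.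 As in the paper, all values $\nu_Q(f)$ ($f\ne0$) lie in $\Gamma$. "For all $Q$ large enough" means for all $Q$ in a final segment of $\mathcal Q$; a family indexed by $\mathcal Q$ is ultimately constant if it is constant on a final segment. For all $Q$ large enough, $I(Q)=\{s_\infty\}$ for a fixed integer $s_\infty\ge1$. $f$ is $\mathcal Q$-stable if $\nu_Q(f)=\nu(f)$ for all $Q$ large enough, $\mathcal Q$-unstable otherwise. Assume unstable polynomials exist; limit key polynomials are the monic $\mathcal Q$-unstable polynomials of minimal degree, forming $\mathrm{KP}_\infty(\mathcal Q)$. Fix $F\in\mathrm{KP}_\infty(\mathcal Q)$, $D=\lfloor\deg F/m\rfloor$, $F=\sum_{\ell=0}^DF_{Q,\ell}Q^\ell$, $\beta_{Q,\ell}=\nu(F_{Q,\ell})\in\Gamma\cup\{\infty\}$. Let $\delta^L$ be the smallest initial segment of $\Gamma$ containing $\{\nu_Q(F):Q\in\mathcal Q\}$; write $x>\delta^L$ if $x\in(\Gamma\setminus\delta^L)\cup\{\infty\}$. Let $J$ be the set of $\ell\in\{0,\dots,D\}$ with $\beta_{Q,\ell}+\ell\gamma_Q>\delta^L$ for all $Q$ large enough, $B=\{0,\dots,D\}\setminus J$, and $B^{ct}$ the set of $\ell\in B$ for which $(\beta_{Q,\ell})_Q$ is ultimately constant. A cut $\eta=(\eta^L,\eta^R)$ of $\Gamma$ is vertically bounded if for every $x\in\eta^L$ and rational $q>1$ there is $y\in\eta^L$ with $q(y-x)>z-x$ for all $z\in\eta^L$. Let $\gamma_{\mathcal Q}$ be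 the cut whose lower set is the smallest initial segment of $\Gamma$ containing $\{\gamma_Q\}$; $\mathcal Q$ is vertically unbounded if $\gamma_{\mathcal Q}$ is not vertically bounded. For $\ell\in\{0,\dots,D\}$, $\mathcal B_\ell$ is the smallest initial segment of $\Gamma$ containing all $\beta\in\Gamma$ such that $\beta+\ell\gamma_Q\in\delta^L$ for some $Q\in\mathcal Q$. $B^{unb}$ is the set of $\ell\in B$ such that for every $\beta\in\mathcal B_\ell$ one has $\beta_{Q,\ell}\ge\beta$ for all $Q$ large enough. *)

theory Defs
  imports "HOL-Computational_Algebra.Polynomial" "HOL-Library.Extended"
begin

(* Values of nu live in Lambda \<union> {\<infinity>}; we use 'g extended, with Pinf = \<infinity>
   (Minf is never a value of nu). *)

fun nmul :: "nat \<Rightarrow> 'g::ab_group_add \<Rightarrow> 'g" where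
  "nmul 0 x = 0"
| "nmul (Suc n) x = x + nmul n x"

(* division by a positive integer in a divisible (torsion-free) group *)
definition gdiv :: "'g::ab_group_add \<Rightarrow> nat \<Rightarrow> 'g" where
  "gdiv x n = (THE y. nmul n y = x)"

fun the_fin :: "'g::zero extended \<Rightarrow> 'g" where
  "the_fin (Fin x) = x"
| "the_fin Pinf = 0"
| "the_fin Minf = 0"

definition poly_valuation ::
  "('k::field poly \<Rightarrow> 'g::linordered_ab_group_add extended) \<Rightarrow> bool" where
  "poly_valuation \<nu> \<longleftrightarrow> \<nu> 0 = Pinf \<and> \<nu> 1 = Fin 0 \<and> (\<forall>f. \<nu> f \<noteq> Minf)
     \<and> (\<forall>f g. \<nu> (f * g) = \<nu> f + \<nu> g) \<and> (\<forall>f g. min (\<nu> f) (\<nu> g) \<le> \<nu> (f + g))"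

definition vK :: "('k::field poly \<Rightarrow> 'g::linordered_ab_group_add extended) \<Rightarrow> 'g set" where
  "vK \<nu> = {g. \<exists>c. c \<noteq> 0 \<and> \<nu> [:c:] = Fin g}"

definition Gam :: "('k::field poly \<Rightarrow> 'g::linordered_ab_group_add extended) \<Rightarrow> 'g set" where
  "Gam \<nu> = {g. \<exists>n>0. nmul n g \<in> vK \<nu>}"

definition value_group :: "('k::field poly \<Rightarrow> 'g::linordered_ab_group_add extended) \<Rightarrow> 'g set" where
  "value_group \<nu> = {a - b | a b. \<exists>f g. \<nu> f = Fin a \<and> \<nu> g = Fin b}"

(* residue field of nu is algebraic over that of v: every residue of f/g (nu f \<ge> nu g < \<infinity>)
   is a root of a nonzero polynomial over k_v, i.e. there are a_0..a_n in O_v, not all in m_v,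
   with nu(\<Sum> a_i f^i g^(n-i)) > nu(g^n). *)
definition residue_algebraic ::
  "('k::field poly \<Rightarrow> 'g::linordered_ab_group_add extended) \<Rightarrow> bool" where
  "residue_algebraic \<nu> \<longleftrightarrow> (\<forall>f g. \<nu> g \<noteq> Pinf \<and> \<nu> g \<le> \<nu> f \<longrightarrow>
     (\<exists>n a. (\<forall>i\<le>n. Fin 0 \<le> \<nu> [:a i:]) \<and> (\<exists>i\<le>n. \<nu> [:a i:] = Fin 0) \<and>
        \<nu> (g ^ n) < \<nu> (\<Sum>i\<le>n. smult (a i) (f ^ i * g ^ (n - i)))))"

definition well_specified ::
  "('k::field poly \<Rightarrow> 'g::linordered_ab_group_add extended) \<Rightarrow> bool" where
  "well_specified \<nu> \<longleftrightarrow> \<not> ((\<forall>f. \<nu> f = Pinf \<longleftrightarrow> f = 0)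
      \<and> (\<forall>t\<in>value_group \<nu>. \<exists>n>0. nmul n t \<in> Gam \<nu>)
      \<and> residue_algebraic \<nu>)"

(* s-th Hasse-Schmidt derivative: coefficient of y^s in f(x+y) *)
definition hasse :: "nat \<Rightarrow> 'k::field poly \<Rightarrow> 'k poly" where
  "hasse s f = coeff (pcompose (map_poly (\<lambda>c. [:c:]) f) [:[:0, 1:], 1:]) s"

(* level of a nonconstant f with nu f < \<infinity> *)
definition level :: "('k::field poly \<Rightarrow> 'g::linordered_ab_group_add extended) \<Rightarrow> 'k poly \<Rightarrow> 'g" where
  "level \<nu> f = Max {gdiv (a - b) s | s a b. 1 \<le> s \<and> \<nu> f = Fin a \<and> \<nu> (hasse s f) = Fin b}"

definition Iset :: "('k::field poly \<Rightarrow> 'g::linordered_ab_group_add extended) \<Rightarrow> 'k poly \<Rightarrow> nat set" where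
  "Iset \<nu> f = {s. 1 \<le> s \<and> (\<exists>a b. \<nu> f = Fin a \<and> \<nu> (hasse s f) = Fin b \<and> gdiv (a - b) s = level \<nu> f)}"

(* key polynomial; constants have level -\<infinity> *)
definition key_poly :: "('k::field poly \<Rightarrow> 'g::linordered_ab_group_add extended) \<Rightarrow> 'k poly \<Rightarrow> bool" where
  "key_poly \<nu> Q \<longleftrightarrow> lead_coeff Q = 1 \<and> 0 < degree Q \<and> \<nu> Q \<noteq> Pinf \<and>
     (\<forall>f. 0 < degree f \<and> degree f < degree Q \<longrightarrow> \<nu> f \<noteq> Pinf \<and> level \<nu> f < level \<nu> Q)"

definition Psi :: "('k::field poly \<Rightarrow> 'g::linordered_ab_group_add extended) \<Rightarrow> nat \<Rightarrow> 'k poly set" where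
  "Psi \<nu> m = {Q. key_poly \<nu> Q \<and> degree Q = m}"

definition qcoeff :: "'k::field poly \<Rightarrow> 'k poly \<Rightarrow> nat \<Rightarrow> 'k poly" where
  "qcoeff Q f i = (f div Q ^ i) mod Q"

definition nuQ :: "('k::field poly \<Rightarrow> 'g::linordered_ab_group_add extended) \<Rightarrow> 'k poly \<Rightarrow> 'k poly \<Rightarrow> 'g extended" where
  "nuQ \<nu> Q f = Min {\<nu> (qcoeff Q f i * Q ^ i) | i. i \<le> degree f}"

definition wo_by_value :: "('k::field poly \<Rightarrow> 'g::linordered_ab_group_add extended) \<Rightarrow> 'k poly set \<Rightarrow> bool" where
  "wo_by_value \<nu> QQ \<longleftrightarrow> inj_on \<nu> QQ \<and>
     (\<forall>S \<subseteq> QQ. S \<noteq> {} \<longrightarrow> (\<exists>Q\<in>S. \<forall>R\<in>S. \<nu> Q \<le> \<nu> R))"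

definition ev :: "('k::field poly \<Rightarrow> 'g::linordered_ab_group_add extended) \<Rightarrow> 'k poly set \<Rightarrow> ('k poly \<Rightarrow> bool) \<Rightarrow> bool" where
  "ev \<nu> QQ P \<longleftrightarrow> (\<exists>Q0\<in>QQ. \<forall>Q\<in>QQ. \<nu> Q0 \<le> \<nu> Q \<longrightarrow> P Q)"

definition stable :: "('k::field poly \<Rightarrow> 'g::linordered_ab_group_add extended) \<Rightarrow> 'k poly set \<Rightarrow> 'k poly \<Rightarrow> bool" where
  "stable \<nu> QQ f \<longleftrightarrow> ev \<nu> QQ (\<lambda>Q. nuQ \<nu> Q f = \<nu> f)"

definition KP_inf :: "('k::field poly \<Rightarrow> 'g::linordered_ab_group_add extended) \<Rightarrow> 'k poly set \<Rightarrow> 'k poly set" where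
  "KP_inf \<nu> QQ = {F. lead_coeff F = 1 \<and> \<not> stable \<nu> QQ F \<and>
      (\<forall>G. lead_coeff G = 1 \<and> \<not> stable \<nu> QQ G \<longrightarrow> degree F \<le> degree G)}"

(* lower set of the cut gamma_QQ *)
definition gammaL :: "('k::field poly \<Rightarrow> 'g::linordered_ab_group_add extended) \<Rightarrow> 'k poly set \<Rightarrow> 'g set" where
  "gammaL \<nu> QQ = {g \<in> Gam \<nu>. \<exists>Q\<in>QQ. g \<le> the_fin (\<nu> Q)}"

(* a cut with lower set L is vertically bounded; q = a/b rational > 1 *)
definition vert_bounded :: "'g::linordered_ab_group_add set \<Rightarrow> bool" where
  "vert_bounded L \<longleftrightarrow> (\<forall>x\<in>L. \<forall>a b::nat. 0 < b \<and> b < a \<longrightarrow>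
      (\<exists>y\<in>L. \<forall>z\<in>L. z - x < gdiv (nmul a (y - x)) b))"

definition vert_unbounded :: "('k::field poly \<Rightarrow> 'g::linordered_ab_group_add extended) \<Rightarrow> 'k poly set \<Rightarrow> bool" where
  "vert_unbounded \<nu> QQ \<longleftrightarrow> \<not> vert_bounded (gammaL \<nu> QQ)"

definition deltaL :: "('k::field poly \<Rightarrow> 'g::linordered_ab_group_add extended) \<Rightarrow> 'k poly set \<Rightarrow> 'k poly \<Rightarrow> 'g set" where
  "deltaL \<nu> QQ F = {g \<in> Gam \<nu>. \<exists>Q\<in>QQ. Fin g \<le> nuQ \<nu> Q F}"

definition above :: "('k::field poly \<Rightarrow> 'g::linordered_ab_group_add extended) \<Rightarrow> 'k poly set \<Rightarrow> 'k poly \<Rightarrow> 'g extended \<Rightarrow> bool" where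
  "above \<nu> QQ F x \<longleftrightarrow> x = Pinf \<or> (\<exists>g. x = Fin g \<and> g \<in> Gam \<nu> \<and> g \<notin> deltaL \<nu> QQ F)"

definition beta :: "('k::field poly \<Rightarrow> 'g::linordered_ab_group_add extended) \<Rightarrow> 'k poly \<Rightarrow> 'k poly \<Rightarrow> nat \<Rightarrow> 'g extended" where
  "beta \<nu> Q F l = \<nu> (qcoeff Q F l)"

definition Jset :: "('k::field poly \<Rightarrow> 'g::linordered_ab_group_add extended) \<Rightarrow> 'k poly set \<Rightarrow> nat \<Rightarrow> 'k poly \<Rightarrow> nat set" where
  "Jset \<nu> QQ m F = {l. l \<le> degree F div m \<and>
      ev \<nu> QQ (\<lambda>Q. above \<nu> QQ F (beta \<nu> Q F l + Fin (nmul l (the_fin (\<nu> Q)))))}"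

definition Bset :: "('k::field poly \<Rightarrow> 'g::linordered_ab_group_add extended) \<Rightarrow> 'k poly set \<Rightarrow> nat \<Rightarrow> 'k poly \<Rightarrow> nat set" where
  "Bset \<nu> QQ m F = {0..degree F div m} - Jset \<nu> QQ m F"

definition Bct :: "('k::field poly \<Rightarrow> 'g::linordered_ab_group_add extended) \<Rightarrow> 'k poly set \<Rightarrow> nat \<Rightarrow> 'k poly \<Rightarrow> nat set" where
  "Bct \<nu> QQ m F = {l \<in> Bset \<nu> QQ m F. \<exists>c. ev \<nu> QQ (\<lambda>Q. beta \<nu> Q F l = c)}"

definition calB :: "('k::field poly \<Rightarrow> 'g::linordered_ab_group_add extended) \<Rightarrow> 'k poly set \<Rightarrow> 'k poly \<Rightarrow> nat \<Rightarrow> 'g set" where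
  "calB \<nu> QQ F l = {b \<in> Gam \<nu>. \<exists>\<beta>\<in>Gam \<nu>. b \<le> \<beta> \<and>
      (\<exists>Q\<in>QQ. \<beta> + nmul l (the_fin (\<nu> Q)) \<in> deltaL \<nu> QQ F)}"

definition Bunb :: "('k::field poly \<Rightarrow> 'g::linordered_ab_group_add extended) \<Rightarrow> 'k poly set \<Rightarrow> nat \<Rightarrow> 'k poly \<Rightarrow> nat set" where
  "Bunb \<nu> QQ m F = {l \<in> Bset \<nu> QQ m F. \<forall>\<beta>\<in>calB \<nu> QQ F l. ev \<nu> QQ (\<lambda>Q. Fin \<beta> \<le> beta \<nu> Q F l)}"

end

theory Submission
  imports Defs
begin

text \<open>
  For key polynomials \<open>Q\<close>, \<open>R = Q + a\<close> of degree \<open>m\<close> with \<open>\<nu> Q < \<nu> R\<close>, substituting \<open>R = Q + a\<close> in the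
  \<open>R\<close>-expansion of \<open>F\<close> expresses the \<open>Q\<close>-coefficients through the \<open>R\<close>-coefficients up to carries in
  products of polynomials of degree less than \<open>m\<close>. A carry raises the value, because such
  polynomials have level below that of \<open>Q\<close>: their Taylor expansions \<open>f(x + y)\<close> are dominated by
  \<open>f(x)\<close> when \<open>y\<close> gets the value \<open>level \<nu> Q\<close>, whereas that of \<open>Q\<close> is not.

  Vertical unboundedness says that the values \<open>\<nu> R - \<nu> Q\<close> for suitable \<open>Q\<close> exceed every multiple of
  each of them. If all \<open>Q \<in> QQ\<close> have this property, descending induction on \<open>j\<close> shows that the values of
  the \<open>j\<close>-th coefficients are ultimately constant or eventually exceed every element of \<open>calB\<close>: the
  coefficients of index \<open>i > j\<close> only contribute terms of arbitrarily large value to it.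
  If some \<open>Q0\<close> fails it, its value lies infinitely far below, hence so does its level,
  and the carries are negligible. For \<open>l > 0\<close> the \<open>l\<close>-th coefficient at \<open>R\<close> is then the residue
  modulo \<open>R\<close> of the formal \<open>l\<close>-th Hasse derivative of \<open>F\<close> with respect to \<open>Q\<close>, which has smaller degree
  than \<open>F\<close> and so is stable: all \<open>l > 0\<close> in \<open>B\<close> are ultimately constant.
\<close>

subsection \<open>Multiples in ordered abelian groups\<close>

lemma nmul_add: "nmul (i + j) x = nmul i x + nmul j (x::'g::ab_group_add)"
  by (induction i) (auto simp: algebra_simps)

lemma nmul_plus: "nmul n (x + y) = nmul n x + nmul n (y::'g::ab_group_add)"
  by (induction n) (auto simp: algebra_simps)

lemma nmul_minus: "nmul n (x - y) = nmul n x - nmul n (y::'g::ab_group_add)"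
  by (induction n) (auto simp: algebra_simps)

lemma nmul_mult: "nmul (i * j) x = nmul i (nmul j (x::'g::ab_group_add))"
  by (induction i) (auto simp: nmul_add)

lemma nmul_zero [simp]: "nmul n (0::'g::ab_group_add) = 0"
  by (induction n) auto

lemma nmul_one [simp]: "nmul (Suc 0) (x::'g::ab_group_add) = x"
  by simp

lemma nmul_mono: "x \<le> y \<Longrightarrow> nmul n x \<le> nmul n (y::'g::linordered_ab_group_add)"
  by (induction n) (auto intro: add_mono)

lemma nmul_strict_mono: "x < y \<Longrightarrow> 0 < n \<Longrightarrow> nmul n x < nmul n (y::'g::linordered_ab_group_add)"
proof (induction n)
  case (Suc n)
  then show ?case
    using nmul_mono[of x y n] by (auto intro: add_less_le_mono)
qed simp

lemma nmul_nonneg: "0 \<le> x \<Longrightarrow> 0 \<le> nmul n (x::'g::linordered_ab_group_add)"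
  using nmul_mono[of 0 x n] by simp

lemma nmul_mono_left:
  "i \<le> j \<Longrightarrow> 0 \<le> x \<Longrightarrow> nmul i x \<le> nmul j (x::'g::linordered_ab_group_add)"
  using nmul_nonneg[of x "j - i"] nmul_add[of i "j - i" x] by simp

lemma nmul_less_cancel:
  "0 < n \<Longrightarrow> nmul n x < nmul n y \<longleftrightarrow> x < (y::'g::linordered_ab_group_add)"
  by (meson nmul_mono nmul_strict_mono not_le)

lemma nmul_le_cancel:
  "0 < n \<Longrightarrow> nmul n x \<le> nmul n y \<longleftrightarrow> x \<le> (y::'g::linordered_ab_group_add)"
  by (meson nmul_mono nmul_strict_mono not_le)

lemma nmul_inject:
  "0 < n \<Longrightarrow> nmul n x = nmul n y \<longleftrightarrow> x = (y::'g::linordered_ab_group_add)"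
  by (metis nmul_less_cancel neq_iff)

text \<open>An ordered group is torsion-free, so the quotient is unique and the definite description
  in \<open>gdiv\<close> denotes it.\<close>

lemma nmul_gdiv:
  fixes x :: "'g::linordered_ab_group_add"
  assumes "\<forall>x::'g. \<forall>n>0. \<exists>y. nmul n y = x" "0 < n"
  shows "nmul n (gdiv x n) = x"
proof -
  obtain y where y: "nmul n y = x" using assms by blast
  have "gdiv x n = y"
    unfolding gdiv_def using y assms(2) by (auto simp: nmul_inject)
  then show ?thesis using y by simp
qed

text \<open>Take the largest of the indices at which the minimum is attained. For the terms of a
  \<open>Q\<close>-expansion this index will determine the degree in \<open>y\<close> of the initial
  form.\<close>

lemma ex_last_minimizer:
  fixes f :: "nat \<Rightarrow> 'a::linorder"
  assumes "finite A" "A \<noteq> {}"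
  shows "\<exists>j\<in>A. \<forall>i\<in>A. f j \<le> f i \<and> (j < i \<longrightarrow> f j < f i)"
proof -
  define S where "S = {i\<in>A. f i = Min (f ` A)}"
  have "Min (f ` A) \<in> f ` A" using assms by (intro Min_in) auto
  then obtain x where "x \<in> A" "f x = Min (f ` A)" by (metis imageE)
  then have S: "finite S" "S \<noteq> {}" using assms unfolding S_def by auto
  let ?j = "Max S"
  have "?j \<in> S" using S by (rule Max_in)
  then have j: "?j \<in> A" "f ?j = Min (f ` A)" unfolding S_def by auto
  have le: "f ?j \<le> f i" if "i \<in> A" for i using j that assms by simp
  have "f ?j < f i" if "i \<in> A" "?j < i" for i
  proof (rule ccontr)
    assume "\<not> f ?j < f i"
    with le[OF that(1)] j that have "i \<in> S" unfolding S_def by auto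
    then have "i \<le> ?j" using S by simp
    with that show False by simp
  qed
  with le j show ?thesis by blast
qed

lemma Fin_le_mono: "d \<le> c \<Longrightarrow> Fin c \<le> x \<Longrightarrow> Fin d \<le> (x::'a::linorder extended)"
  by (cases x) auto

lemma Fin_less_mono: "d \<le> c \<Longrightarrow> Fin c < x \<Longrightarrow> Fin d < (x::'a::linorder extended)"
  by (cases x) auto

lemma Fin_less_le_mono: "d < c \<Longrightarrow> Fin c \<le> x \<Longrightarrow> Fin d < (x::'a::linorder extended)"
  by (cases x) auto

subsection \<open>Taylor expansion\<close>

text \<open>The Taylor expansion \<open>f(x + y)\<close>, read as a polynomial in the outer variable
  \<open>y\<close> over \<open>K[x]\<close>. Unlike the single Hasse derivatives, which are its
  coefficients, it is multiplicative in \<open>f\<close>.\<close>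

definition shift :: "'k::field poly \<Rightarrow> 'k poly poly" where
  "shift f = pcompose (map_poly (\<lambda>c. [:c:]) f) [:[:0, 1:], 1:]"

lemma hasse_eq_coeff_shift: "hasse s f = coeff (shift f) s"
  by (simp add: hasse_def shift_def)

lemma sum_const_poly: "[:sum f A:] = (\<Sum>i\<in>A. [:f i :: 'k::field:])"
  by (rule poly_eqI) (simp add: coeff_sum coeff_pCons split: nat.split)

lemma shift_add: "shift (f + g) = shift f + shift g"
proof -
  have "map_poly (\<lambda>c. [:c:]) (f + g) = map_poly (\<lambda>c. [:c:]) f + map_poly (\<lambda>c. [:c:]) g"
    by (rule poly_eqI) (simp add: coeff_map_poly)
  then show ?thesis by (simp add: shift_def pcompose_add)
qed

lemma shift_mult: "shift (f * g) = shift f * shift g"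
proof -
  have "map_poly (\<lambda>c. [:c:]) (f * g) = map_poly (\<lambda>c. [:c:]) f * map_poly (\<lambda>c. [:c:]) g"
    by (rule poly_eqI) (simp add: coeff_map_poly coeff_mult sum_const_poly mult.commute)
  then show ?thesis by (simp add: shift_def pcompose_mult)
qed

lemma shift_const: "shift [:c:] = [:[:c:]:]"
  by (simp add: shift_def map_poly_pCons)

lemma shift_0 [simp]: "shift 0 = 0" and shift_1 [simp]: "shift 1 = 1"
  using shift_const[of 0] shift_const[of 1] by (simp_all add: one_pCons)

lemma shift_sum: "shift (sum f A) = (\<Sum>i\<in>A. shift (f i))"
  by (induction A rule: infinite_finite_induct) (auto simp: shift_add)

lemma shift_power: "shift (f ^ n) = shift f ^ n"
  by (induction n) (auto simp: shift_mult)

lemma shift_diff: "shift (f - g) = shift f - shift g"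
  using shift_add[of "f - g" g] by simp

lemma poly_map_const: "poly (map_poly (\<lambda>c. [:c:]) f) [:0, 1:] = (f :: 'k::field poly)"
proof (induction f)
  case (pCons a p)
  have "map_poly (\<lambda>c. [:c:]) (pCons a p) = pCons [:a:] (map_poly (\<lambda>c. [:c:]) p)"
    using pCons by (simp add: map_poly_pCons)
  then show ?case using pCons by simp
qed simp

lemma coeff_shift_0 [simp]: "coeff (shift f) 0 = f"
proof -
  have "coeff (shift f) 0 = poly (shift f) 0" by (simp add: poly_0_coeff_0)
  also have "\<dots> = f" by (simp add: shift_def poly_pcompose poly_map_const)
  finally show ?thesis .
qed

lemma degree_map_const: "degree (map_poly (\<lambda>c. [:c:]) f) = degree (f :: 'k::field poly)"
  by (rule degree_map_poly) auto

lemma degree_shift: "degree (shift f) = degree f"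
  by (simp add: shift_def degree_map_const degree_pcompose)

text \<open>For nonzero \<open>f\<close> this coefficient is a nonzero constant, hence of finite
  value; this is why the set whose maximum defines the level is nonempty.\<close>

lemma coeff_shift_degree: "coeff (shift f) (degree f) = [:lead_coeff f:]"
proof -
  have "lead_coeff (shift f) = [:lead_coeff f:]"
    unfolding shift_def
    by (subst lead_coeff_comp) (simp_all add: degree_map_const coeff_map_poly)
  then show ?thesis by (simp add: degree_shift)
qed

subsection \<open>\<open>Q\<close>-expansions\<close>

lemma qcoeff_zero [simp]: "qcoeff Q 0 i = 0"
  by (simp add: qcoeff_def)

lemma qcoeff_add: "qcoeff Q (f + g) i = qcoeff Q f i + qcoeff Q g i"
  by (simp add: qcoeff_def poly_div_add_left poly_mod_add_left)

lemma qcoeff_sum: "qcoeff Q (sum f A) i = (\<Sum>k\<in>A. qcoeff Q (f k) i)"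
  by (induction A rule: infinite_finite_induct) (auto simp: qcoeff_add)

lemma qcoeff_0_eq_mod: "qcoeff Q f 0 = f mod Q"
  by (simp add: qcoeff_def)

lemma degree_qcoeff: "0 < degree Q \<Longrightarrow> degree (qcoeff Q f i) < degree Q"
  unfolding qcoeff_def using degree_mod_less'[of Q "f div Q ^ i"] by force

lemma qcoeff_mult_power:
  assumes "Q \<noteq> 0"
  shows "qcoeff Q (g * Q ^ k) i = (if i < k then 0 else qcoeff Q g (i - k))"
proof (cases "i < k")
  case True
  then have "k = (k - i - 1) + (1 + i)" by simp
  then have "Q ^ k = Q ^ (k - i - 1) * (Q ^ 1 * Q ^ i)"
    by (metis power_add)
  then have "Q ^ k = Q ^ (k - i - 1) * Q * Q ^ i"
    by (simp add: mult.assoc)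
  then have "(g * Q ^ k) div Q ^ i = (g * Q ^ (k - i - 1)) * Q"
    using assms by (simp add: mult.assoc[symmetric])
  then show ?thesis using True by (simp add: qcoeff_def)
next
  case False
  then have "Q ^ i = Q ^ k * Q ^ (i - k)" by (metis le_add_diff_inverse not_less power_add)
  then have "(g * Q ^ k) div Q ^ i = g div Q ^ (i - k)"
    using assms by (simp add: poly_div_mult_right)
  then show ?thesis using False by (simp add: qcoeff_def)
qed

lemma qcoeff_eq_0:
  assumes "degree f < i * degree Q"
  shows "qcoeff Q f i = 0"
proof -
  have "Q \<noteq> 0" using assms by auto
  then have "degree f < degree (Q ^ i)" using assms by (simp add: degree_power_eq)
  then show ?thesis by (simp add: qcoeff_def div_poly_less)
qed

text \<open>Repeated division by \<open>Q\<close> leaves a remaining term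
  \<open>(f div Q ^ k) * Q ^ k\<close>, which vanishes once \<open>Q ^ k\<close> has larger degree
  than \<open>f\<close>.\<close>

lemma qexpansion:
  assumes "0 < degree Q" "degree f \<le> n"
  shows "f = (\<Sum>i\<le>n. qcoeff Q f i * Q ^ i)"
proof -
  have *: "f = (\<Sum>i<k. qcoeff Q f i * Q ^ i) + (f div Q ^ k) * Q ^ k" for k
  proof (induction k)
    case (Suc k)
    have "f div Q ^ k = (f div Q ^ k) div Q * Q + qcoeff Q f k"
      by (simp add: qcoeff_def)
    also have "(f div Q ^ k) div Q = f div Q ^ Suc k"
      by (simp only: power_Suc2 poly_div_mult_right)
    finally have "(f div Q ^ k) * Q ^ k = (f div Q ^ Suc k * Q + qcoeff Q f k) * Q ^ k"
      by simp
    then have "(f div Q ^ k) * Q ^ k = qcoeff Q f k * Q ^ k + (f div Q ^ Suc k) * Q ^ Suc k"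
      by (simp add: algebra_simps)
    with Suc show ?case by (simp add: add.assoc)
  qed simp
  have "n < degree (Q ^ Suc n)"
    using assms(1) mult_le_mono2[of 1 "degree Q" "Suc n"] by (subst degree_power_eq) auto
  then have "f div Q ^ Suc n = 0" using assms(2) by (intro div_poly_less) simp
  with *[of "Suc n"] show ?thesis by (simp add: lessThan_Suc_atMost)
qed

text \<open>A digit has at most the degree of the quotient \<open>f div Q ^ i\<close>, and the
  remainder modulo \<open>Q ^ i\<close> cannot cancel the leading term of that quotient times
  \<open>Q ^ i\<close>. This will bound the degree of a formal Hasse derivative with respect to
  \<open>Q\<close>.\<close>

lemma degree_qcoeff_mult_power_le:
  assumes "0 < degree Q" "qcoeff Q f i \<noteq> 0"
  shows "degree (qcoeff Q f i * Q ^ i) \<le> degree f"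
proof -
  have Q: "Q \<noteq> 0" using assms(1) by auto
  let ?g = "f div Q ^ i"
  have g: "?g \<noteq> 0" using assms(2) by (auto simp: qcoeff_def)
  have "degree (qcoeff Q f i) \<le> degree ?g"
    unfolding qcoeff_def
    by (cases "degree ?g < degree Q")
      (use degree_mod_less[OF Q, of ?g] in \<open>auto simp: mod_poly_less\<close>)
  moreover have "degree ?g + degree (Q ^ i) \<le> degree f"
  proof -
    have d: "degree (?g * Q ^ i) = degree ?g + degree (Q ^ i)"
      using g Q by (intro degree_mult_eq) auto
    show ?thesis
    proof (cases "f mod Q ^ i = 0")
      case True
      then have "f = ?g * Q ^ i" by (metis add.right_neutral div_mult_mod_eq)
      then show ?thesis using d by simp
    next
      case False
      then have "degree (f mod Q ^ i) < degree (?g * Q ^ i)"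
        using degree_mod_less'[of "Q ^ i" f] Q d by simp
      then have "degree (?g * Q ^ i + f mod Q ^ i) = degree (?g * Q ^ i)"
        by (rule degree_add_eq_left)
      then show ?thesis using d by (simp only: div_mult_mod_eq)
    qed
  qed
  ultimately show ?thesis
    using degree_mult_le[of "qcoeff Q f i" "Q ^ i"] by linarith
qed

subsection \<open>Gauss extensions of a valuation\<close>

locale pval =
  fixes \<nu> :: "'k::field poly \<Rightarrow> 'g::linordered_ab_group_add extended"
  assumes val: "poly_valuation \<nu>"
begin

lemma v_0 [simp]: "\<nu> 0 = Pinf"
  and v_1 [simp]: "\<nu> 1 = Fin 0"
  and v_not_Minf [simp]: "\<nu> f \<noteq> Minf"
  and v_mult: "\<nu> (f * g) = \<nu> f + \<nu> g"
  and v_add: "min (\<nu> f) (\<nu> g) \<le> \<nu> (f + g)"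
  using val by (auto simp: poly_valuation_def)

lemma v_add_ge: "x \<le> \<nu> f \<Longrightarrow> x \<le> \<nu> g \<Longrightarrow> x \<le> \<nu> (f + g)"
  using v_add[of f g] by (meson min.boundedI order_trans)

lemma v_add_gt: "x < \<nu> f \<Longrightarrow> x < \<nu> g \<Longrightarrow> x < \<nu> (f + g)"
  using v_add[of f g] by (metis less_le_trans min_less_iff_conj)

lemma v_uminus [simp]: "\<nu> (- f) = \<nu> f"
proof -
  have "\<nu> (-1) + \<nu> (-1) = Fin 0" using v_mult[of "-1" "-1"] by simp
  then have "\<nu> (-1) = Fin 0"
    by (cases "\<nu> (-1)") (auto simp: double_zero)
  then show ?thesis using v_mult[of "-1" f] by (cases "\<nu> f") auto
qed

lemma v_diff_ge: "x \<le> \<nu> f \<Longrightarrow> x \<le> \<nu> g \<Longrightarrow> x \<le> \<nu> (f - g)"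
  using v_add_ge[of x f "- g"] by simp

lemma v_sum_ge: "(\<And>i. i \<in> A \<Longrightarrow> x \<le> \<nu> (f i)) \<Longrightarrow> x \<le> \<nu> (sum f A)"
  by (induction A rule: infinite_finite_induct) (auto intro: v_add_ge)

text \<open>The bound is finite because an empty sum has value \<open>Pinf\<close>, which does not
  exceed itself.\<close>

lemma v_sum_gt: "(\<And>i. i \<in> A \<Longrightarrow> Fin x < \<nu> (f i)) \<Longrightarrow> Fin x < \<nu> (sum f A)"
  by (induction A rule: infinite_finite_induct) (auto intro: v_add_gt)

lemma v_add_eq: assumes "\<nu> f < \<nu> g" shows "\<nu> (f + g) = \<nu> f"
proof (rule antisym)
  show "\<nu> f \<le> \<nu> (f + g)" using assms by (intro v_add_ge) auto
  show "\<nu> (f + g) \<le> \<nu> f"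
  proof (rule ccontr)
    assume "\<not> ?thesis"
    then have "\<nu> f < \<nu> (f + g)" by simp
    moreover have "\<nu> f < \<nu> (- g)" using assms by simp
    ultimately have "\<nu> f < \<nu> (f + g + - g)" by (rule v_add_gt)
    then show False by (simp only: add.assoc right_minus add_0_right less_irrefl)
  qed
qed

lemma v_sum_eq:
  assumes "finite A" "i \<in> A" "\<nu> (f i) = Fin c" "\<And>j. j \<in> A \<Longrightarrow> j \<noteq> i \<Longrightarrow> Fin c < \<nu> (f j)"
  shows "\<nu> (sum f A) = Fin c"
proof -
  have "Fin c < \<nu> (sum f (A - {i}))" using assms(4) by (intro v_sum_gt) auto
  then have "\<nu> (f i + sum f (A - {i})) = Fin c" using v_add_eq[of "f i"] assms(3) by simp
  then show ?thesis using assms(1,2) by (simp add: sum.remove)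
qed

lemma v_mult_ge: "Fin c \<le> \<nu> f \<Longrightarrow> Fin d \<le> \<nu> g \<Longrightarrow> Fin (c + d) \<le> \<nu> (f * g)"
  by (cases "\<nu> f"; cases "\<nu> g") (auto simp: v_mult intro: add_mono)

lemma v_mult_gt1: "Fin c < \<nu> f \<Longrightarrow> Fin d \<le> \<nu> g \<Longrightarrow> Fin (c + d) < \<nu> (f * g)"
  by (cases "\<nu> f"; cases "\<nu> g") (auto simp: v_mult intro: add_less_le_mono)

lemma v_mult_gt2: "Fin c \<le> \<nu> f \<Longrightarrow> Fin d < \<nu> g \<Longrightarrow> Fin (c + d) < \<nu> (f * g)"
  by (cases "\<nu> f"; cases "\<nu> g") (auto simp: v_mult intro: add_le_less_mono)

lemma v_const_finite: assumes "c \<noteq> 0" obtains g where "\<nu> [:c:] = Fin g"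
proof -
  have "\<nu> [:c:] + \<nu> [:inverse c:] = Fin 0"
    using v_mult[of "[:c:]" "[:inverse c:]"] assms by (simp flip: one_pCons)
  then show ?thesis using that by (cases "\<nu> [:c:]"; cases "\<nu> [:inverse c:]") auto
qed

lemma v_of_nat: "Fin 0 \<le> \<nu> (of_nat n)"
  by (induction n) (auto intro: v_add_ge)

lemma v_power: "\<nu> Q = Fin \<gamma> \<Longrightarrow> \<nu> (Q ^ n) = Fin (nmul n \<gamma>)"
  by (induction n) (auto simp: v_mult)

lemma v_mult_power_le_iff:
  "\<nu> Q = Fin \<gamma> \<Longrightarrow> Fin c \<le> \<nu> (f * Q ^ i) \<longleftrightarrow> Fin (c - nmul i \<gamma>) \<le> \<nu> f"
  by (cases "\<nu> f") (auto simp: v_mult v_power algebra_simps)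

lemma v_mult_power_less_iff:
  "\<nu> Q = Fin \<gamma> \<Longrightarrow> Fin c < \<nu> (f * Q ^ i) \<longleftrightarrow> Fin (c - nmul i \<gamma>) < \<nu> f"
  by (cases "\<nu> f") (auto simp: v_mult v_power algebra_simps)

section \<open>Gauss valuations on \<open>K[x][y]\<close> and initial forms in
  \<open>y\<close>\<close>

text \<open>The Gauss extension of \<open>\<nu>\<close> that gives \<open>y\<close> the value
  \<open>\<epsilon>\<close> is at least \<open>c\<close> on \<open>P\<close>. The weight is moved to
  the finite side, so that no arithmetic with \<open>Pinf\<close> is needed.\<close>

definition gauss_ge :: "'g \<Rightarrow> 'g \<Rightarrow> 'k poly poly \<Rightarrow> bool" where
  "gauss_ge \<epsilon> c P \<longleftrightarrow> (\<forall>s. Fin (c - nmul s \<epsilon>) \<le> \<nu> (coeff P s))"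

text \<open>The Gauss value is exactly \<open>c\<close>, and the initial form has degree
  \<open>n\<close> in \<open>y\<close>.\<close>

definition gauss_top :: "'g \<Rightarrow> 'g \<Rightarrow> nat \<Rightarrow> 'k poly poly \<Rightarrow> bool" where
  "gauss_top \<epsilon> c n P \<longleftrightarrow> gauss_ge \<epsilon> c P \<and> \<nu> (coeff P n) = Fin (c - nmul n \<epsilon>) \<and>
     (\<forall>s>n. Fin (c - nmul s \<epsilon>) < \<nu> (coeff P s))"

text \<open>The part of weight \<open>c\<close> is constant in \<open>y\<close>, and may vanish:
  \<open>c\<close> is only a lower bound for the Gauss value.\<close>

definition gauss_init :: "'g \<Rightarrow> 'g \<Rightarrow> 'k poly poly \<Rightarrow> bool" where
  "gauss_init \<epsilon> c P \<longleftrightarrow> gauss_ge \<epsilon> c P \<and> (\<forall>s>0. Fin (c - nmul s \<epsilon>) < \<nu> (coeff P s))"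

lemma split_weight:
  "i \<le> s \<Longrightarrow> c + d - nmul s \<epsilon> = (c - nmul i \<epsilon>) + (d - nmul (s - i) (\<epsilon>::'g))"
  using nmul_add[of i "s - i" \<epsilon>] by (simp add: algebra_simps)

lemma gauss_ge_mult:
  assumes "gauss_ge \<epsilon> c P" "gauss_ge \<epsilon> d R"
  shows "gauss_ge \<epsilon> (c + d) (P * R)"
  unfolding gauss_ge_def coeff_mult
proof (intro allI v_sum_ge)
  fix s i :: nat assume "i \<in> {..s}"
  then show "Fin (c + d - nmul s \<epsilon>) \<le> \<nu> (coeff P i * coeff R (s - i))"
    using assms by (simp add: split_weight gauss_ge_def v_mult_ge)
qed

lemma gauss_ge_sum: "(\<And>i. i \<in> A \<Longrightarrow> gauss_ge \<epsilon> c (P i)) \<Longrightarrow> gauss_ge \<epsilon> c (sum P A)"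
  by (auto simp: gauss_ge_def coeff_sum intro: v_sum_ge)

lemma gauss_ge_power: "gauss_ge \<epsilon> c P \<Longrightarrow> gauss_ge \<epsilon> (nmul i c) (P ^ i)"
proof (induction i)
  case 0
  then show ?case by (auto simp: gauss_ge_def coeff_1)
qed (auto intro: gauss_ge_mult)

text \<open>As in the Gauss lemma: in the convolution for index \<open>n + k\<close> every pair
  other than \<open>(n, k)\<close> has an entry beyond the top of its factor and so a strictly
  larger value. Degrees of initial forms therefore add.\<close>

lemma gauss_top_mult:
  assumes "gauss_top \<epsilon> c n P" "gauss_top \<epsilon> d k R"
  shows "gauss_top \<epsilon> (c + d) (n + k) (P * R)"
proof -
  have P: "Fin (c - nmul s \<epsilon>) \<le> \<nu> (coeff P s)" "n < s \<Longrightarrow> Fin (c - nmul s \<epsilon>) < \<nu> (coeff P s)" for s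
    using assms(1) by (auto simp: gauss_top_def gauss_ge_def)
  have R: "Fin (d - nmul s \<epsilon>) \<le> \<nu> (coeff R s)" "k < s \<Longrightarrow> Fin (d - nmul s \<epsilon>) < \<nu> (coeff R s)" for s
    using assms(2) by (auto simp: gauss_top_def gauss_ge_def)
  have gt: "Fin (c + d - nmul s \<epsilon>) < \<nu> (coeff P i * coeff R (s - i))"
    if "i \<le> s" "n < i \<or> k < s - i" for s i
    using that(2) v_mult_gt1[OF P(2) R(1), of i "s - i"] v_mult_gt2[OF P(1) R(2), of "s - i" i]
    by (auto simp: split_weight[OF that(1)])
  have "\<nu> (coeff P n * coeff R (n + k - n)) = Fin (c + d - nmul (n + k) \<epsilon>)"
    using assms by (simp add: gauss_top_def v_mult nmul_add algebra_simps)
  then have "\<nu> (coeff (P * R) (n + k)) = Fin (c + d - nmul (n + k) \<epsilon>)"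
    unfolding coeff_mult by (intro v_sum_eq[of _ n] gt) auto
  moreover have "Fin (c + d - nmul s \<epsilon>) < \<nu> (coeff (P * R) s)" if "n + k < s" for s
    unfolding coeff_mult using that by (intro v_sum_gt gt) auto
  ultimately show ?thesis
    using assms gauss_ge_mult by (auto simp: gauss_top_def)
qed

lemma gauss_top_1: "gauss_top \<epsilon> 0 0 1"
  by (auto simp: gauss_top_def gauss_ge_def coeff_1)

lemma gauss_top_power: "gauss_top \<epsilon> c n P \<Longrightarrow> gauss_top \<epsilon> (nmul i c) (n * i) (P ^ i)"
  by (induction i) (auto simp: gauss_top_1 intro: gauss_top_mult)

lemma gauss_init_mult:
  assumes "gauss_init \<epsilon> c P" "gauss_init \<epsilon> d R"
  shows "gauss_init \<epsilon> (c + d) (P * R)"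
proof -
  have P: "Fin (c - nmul s \<epsilon>) \<le> \<nu> (coeff P s)" "0 < s \<Longrightarrow> Fin (c - nmul s \<epsilon>) < \<nu> (coeff P s)" for s
    using assms(1) by (auto simp: gauss_init_def gauss_ge_def)
  have R: "Fin (d - nmul s \<epsilon>) \<le> \<nu> (coeff R s)" "0 < s \<Longrightarrow> Fin (d - nmul s \<epsilon>) < \<nu> (coeff R s)" for s
    using assms(2) by (auto simp: gauss_init_def gauss_ge_def)
  have "Fin (c + d - nmul s \<epsilon>) < \<nu> (coeff (P * R) s)" if "0 < s" for s
    unfolding coeff_mult
  proof (intro v_sum_gt)
    fix i assume "i \<in> {..s}"
    then have i: "i \<le> s" by simp
    show "Fin (c + d - nmul s \<epsilon>) < \<nu> (coeff P i * coeff R (s - i))"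
      unfolding split_weight[OF i]
      using that v_mult_gt1[OF P(2) R(1), of i "s - i"] v_mult_gt2[OF P(1) R(2), of "s - i" i]
      by (cases "i = 0") simp_all
  qed
  then show ?thesis using assms gauss_ge_mult by (auto simp: gauss_init_def)
qed

lemma gauss_init_1: "gauss_init \<epsilon> 0 1"
  by (auto simp: gauss_init_def gauss_ge_def coeff_1)

lemma gauss_init_power: "gauss_init \<epsilon> c P \<Longrightarrow> gauss_init \<epsilon> (nmul i c) (P ^ i)"
  by (induction i) (auto simp: gauss_init_1 intro: gauss_init_mult)

lemma gauss_ge_mono: "gauss_ge \<epsilon> c P \<Longrightarrow> d \<le> c \<Longrightarrow> gauss_ge \<epsilon> d P"
  unfolding gauss_ge_def by (auto intro: Fin_le_mono diff_right_mono)

lemma gauss_init_mono: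
  assumes "gauss_init \<epsilon> c P" "d \<le> c"
  shows "gauss_init \<epsilon> d P"
  using assms gauss_ge_mono unfolding gauss_init_def by (auto intro: Fin_less_mono diff_right_mono)

lemma gauss_init_0: "gauss_init \<epsilon> c 0"
  by (auto simp: gauss_ge_def gauss_init_def)

definition abs_key :: "'k poly \<Rightarrow> 'g \<Rightarrow> 'g \<Rightarrow> nat \<Rightarrow> bool" where
  "abs_key Q \<epsilon> \<gamma> b \<longleftrightarrow> 0 < degree Q \<and> \<nu> Q = Fin \<gamma> \<and> 0 < b \<and> gauss_top \<epsilon> \<gamma> b (shift Q) \<and>
     (\<forall>f. f \<noteq> 0 \<longrightarrow> degree f < degree Q \<longrightarrow> (\<exists>c. \<nu> f = Fin c \<and> gauss_top \<epsilon> c 0 (shift f)))"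

lemma abs_key_small:
  assumes "abs_key Q \<epsilon> \<gamma> b" "degree f < degree Q" "Fin c \<le> \<nu> f"
  shows "gauss_init \<epsilon> c (shift f)"
proof (cases "f = 0")
  case False
  then obtain d where d: "\<nu> f = Fin d" "gauss_top \<epsilon> d 0 (shift f)"
    using assms by (auto simp: abs_key_def)
  then have "gauss_init \<epsilon> d (shift f)" by (auto simp: gauss_init_def gauss_top_def)
  then show ?thesis using assms(3) d(1) by (auto intro: gauss_init_mono)
qed (auto simp: gauss_init_0)

text \<open>The initial form of \<open>h i * Q ^ i\<close> has degree \<open>b * i\<close> in
  \<open>y\<close>. Different indices give different degrees, so the last term of minimal value
  contributes a top coefficient that nothing cancels.\<close>

lemma gauss_top_qexpansion:
  assumes key: "abs_key Q \<epsilon> \<gamma> b"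
    and deg: "\<And>i. i \<in> A \<Longrightarrow> degree (h i) < degree Q"
    and A: "finite A" "j \<in> A"
    and j: "\<nu> (h j * Q ^ j) = Fin c"
    and min: "\<And>i. i \<in> A \<Longrightarrow> Fin c \<le> \<nu> (h i * Q ^ i)"
    and last: "\<And>i. i \<in> A \<Longrightarrow> j < i \<Longrightarrow> Fin c < \<nu> (h i * Q ^ i)"
  shows "gauss_top \<epsilon> c (b * j) (shift (\<Sum>i\<in>A. h i * Q ^ i))"
proof -
  have b: "0 < b" and \<gamma>: "\<nu> Q = Fin \<gamma>" using key by (auto simp: abs_key_def)
  let ?P = "\<lambda>i. shift (h i * Q ^ i)"
  have top: "\<exists>d. \<nu> (h i * Q ^ i) = Fin d \<and> gauss_top \<epsilon> d (b * i) (?P i)"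
    if "i \<in> A" "h i \<noteq> 0" for i
  proof -
    have "degree (h i) < degree Q" "h i \<noteq> 0" using deg that by auto
    then obtain d where d: "\<nu> (h i) = Fin d" "gauss_top \<epsilon> d 0 (shift (h i))"
      using key unfolding abs_key_def by blast
    have "gauss_top \<epsilon> (nmul i \<gamma>) (b * i) (shift Q ^ i)"
      using key by (auto simp: abs_key_def intro: gauss_top_power)
    from gauss_top_mult[OF d(2) this] show ?thesis
      using d \<gamma> by (auto simp: v_mult v_power shift_mult shift_power)
  qed
  have "h j \<noteq> 0" using j by auto
  then have tj: "gauss_top \<epsilon> c (b * j) (?P j)" using top[of j] A j by auto
  have ge: "Fin (c - nmul s \<epsilon>) \<le> \<nu> (coeff (?P i) s)" if "i \<in> A" for i s
  proof (cases "h i = 0")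
    case False
    then obtain d where "\<nu> (h i * Q ^ i) = Fin d" "gauss_ge \<epsilon> d (?P i)"
      using top \<open>i \<in> A\<close> unfolding gauss_top_def by blast
    then have "gauss_ge \<epsilon> c (?P i)" using min[OF that] by (auto intro: gauss_ge_mono)
    then show ?thesis by (auto simp: gauss_ge_def)
  qed simp
  \<comment> \<open>For \<open>i > j\<close> the whole term lies above \<open>c\<close>; for
    \<open>i < j\<close> the index \<open>s\<close> is at least \<open>b * j\<close> and so beyond
    the top \<open>b * i\<close>.\<close>
  have gt: "Fin (c - nmul s \<epsilon>) < \<nu> (coeff (?P i) s)"
    if "i \<in> A" "i \<noteq> j \<and> b * j \<le> s \<or> b * j < s" for i s
  proof (cases "h i = 0")
    case False
    then obtain d where d: "\<nu> (h i * Q ^ i) = Fin d" "gauss_top \<epsilon> d (b * i) (?P i)"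
      using top \<open>i \<in> A\<close> by blast
    show ?thesis
    proof (cases "j < i")
      case True
      then have "c < d" using last[OF that(1)] d by simp
      moreover have "Fin (d - nmul s \<epsilon>) \<le> \<nu> (coeff (?P i) s)"
        using d(2) by (auto simp: gauss_top_def gauss_ge_def)
      ultimately show ?thesis
        by (auto intro: Fin_less_le_mono diff_strict_right_mono)
    next
      case F: False
      have "b * i < s"
      proof (cases "i = j")
        case False
        then have "b * i < b * j" using F b by simp
        then show ?thesis using that(2) by linarith
      qed (use that in auto)
      then have "Fin (d - nmul s \<epsilon>) < \<nu> (coeff (?P i) s)"
        using d(2) by (auto simp: gauss_top_def)
      moreover have "c \<le> d" using min[OF that(1)] d by simp
      ultimately show ?thesis
        by (auto intro: Fin_less_mono diff_right_mono)
    qed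
  qed simp
  show ?thesis
    unfolding gauss_top_def gauss_ge_def shift_sum coeff_sum
  proof (intro conjI allI impI)
    show "\<nu> (\<Sum>i\<in>A. coeff (?P i) (b * j)) = Fin (c - nmul (b * j) \<epsilon>)"
      using tj A gt by (intro v_sum_eq[of _ j]) (auto simp: gauss_top_def)
  qed (auto intro!: v_sum_ge v_sum_gt ge gt)
qed

lemma ex_leading_term:
  assumes key: "abs_key Q \<epsilon> \<gamma> b"
    and deg: "\<And>i. i \<in> A \<Longrightarrow> degree (h i) < degree Q"
    and A: "finite A" "i0 \<in> A" "h i0 \<noteq> 0"
  shows "\<exists>j\<in>A. \<exists>c. \<nu> (h j * Q ^ j) = Fin c \<and> (\<forall>i\<in>A. Fin c \<le> \<nu> (h i * Q ^ i)) \<and>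
    (\<forall>i\<in>A. j < i \<longrightarrow> Fin c < \<nu> (h i * Q ^ i)) \<and>
    gauss_top \<epsilon> c (b * j) (shift (\<Sum>i\<in>A. h i * Q ^ i))"
proof -
  obtain j where j: "j \<in> A" "\<forall>i\<in>A. \<nu> (h j * Q ^ j) \<le> \<nu> (h i * Q ^ i) \<and>
      (j < i \<longrightarrow> \<nu> (h j * Q ^ j) < \<nu> (h i * Q ^ i))"
    using ex_last_minimizer[of A "\<lambda>i. \<nu> (h i * Q ^ i)"] A by blast
  obtain d where "\<nu> (h i0) = Fin d" using key deg[OF A(2)] A(3) unfolding abs_key_def by blast
  moreover have "\<nu> Q = Fin \<gamma>" using key by (auto simp: abs_key_def)
  ultimately have "\<nu> (h i0 * Q ^ i0) = Fin (d + nmul i0 \<gamma>)" by (simp add: v_mult v_power)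
  moreover have "\<nu> (h j * Q ^ j) \<le> \<nu> (h i0 * Q ^ i0)" using j A by blast
  ultimately obtain c where c: "\<nu> (h j * Q ^ j) = Fin c"
    by (cases "\<nu> (h j * Q ^ j)") simp_all
  moreover have "gauss_top \<epsilon> c (b * j) (shift (\<Sum>i\<in>A. h i * Q ^ i))"
    using j c by (intro gauss_top_qexpansion[OF key deg A(1)]) auto
  ultimately show ?thesis using j by auto
qed

text \<open>Let \<open>j\<close> be the last index of minimal value \<open>d\<close> in the
  expansion of \<open>g\<close>. If \<open>j = 0\<close>, the constant coefficient gives
  \<open>c \<le> d\<close> and the later terms exceed \<open>d\<close>. If \<open>j > 0\<close>, the
  coefficient at \<open>b * j > 0\<close> of \<open>shift g\<close> has value above its weight
  bound, so \<open>c < d\<close>. Thus carries gain value.\<close>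

lemma gauss_init_qcoeff:
  assumes key: "abs_key Q \<epsilon> \<gamma> b" and g: "gauss_init \<epsilon> c (shift g)"
  shows "Fin c \<le> \<nu> (qcoeff Q g i * Q ^ i)" "0 < i \<Longrightarrow> Fin c < \<nu> (qcoeff Q g i * Q ^ i)"
proof -
  have dQ: "0 < degree Q" and b: "0 < b" using key by (auto simp: abs_key_def)
  have "Fin c \<le> \<nu> (qcoeff Q g i * Q ^ i) \<and> (0 < i \<longrightarrow> Fin c < \<nu> (qcoeff Q g i * Q ^ i))"
  proof (cases "qcoeff Q g i = 0")
    case False
    define n where "n = max i (degree g)"
    have g_eq: "g = (\<Sum>i\<le>n. qcoeff Q g i * Q ^ i)"
      by (rule qexpansion[OF dQ]) (simp add: n_def)
    obtain j d where j: "j \<le> n" "\<nu> (qcoeff Q g j * Q ^ j) = Fin d"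
      "\<forall>i\<le>n. Fin d \<le> \<nu> (qcoeff Q g i * Q ^ i)"
      "\<forall>i\<le>n. j < i \<longrightarrow> Fin d < \<nu> (qcoeff Q g i * Q ^ i)"
      "gauss_top \<epsilon> d (b * j) (shift g)"
      using ex_leading_term[OF key, of "{..n}" "qcoeff Q g" i] False degree_qcoeff[OF dQ]
      unfolding g_eq[symmetric] by (auto simp: n_def)
    have i: "i \<le> n" by (simp add: n_def)
    have eq: "\<nu> (coeff (shift g) (b * j)) = Fin (d - nmul (b * j) \<epsilon>)"
      using j(5) by (auto simp: gauss_top_def)
    show ?thesis
    proof (cases "j = 0")
      case True
      have "Fin (c - nmul 0 \<epsilon>) \<le> \<nu> (coeff (shift g) 0)"
        using g unfolding gauss_init_def gauss_ge_def by blast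
      then have "c \<le> d" using eq True by simp
      then show ?thesis using j i True
        by (auto intro: Fin_le_mono Fin_less_mono)
    next
      case False
      then have "Fin (c - nmul (b * j) \<epsilon>) < \<nu> (coeff (shift g) (b * j))"
        using g b by (auto simp: gauss_init_def)
      then have "c < d" using eq by simp
      then show ?thesis using j i
        by (auto intro: Fin_less_le_mono less_imp_le)
    qed
  qed simp
  then show "Fin c \<le> \<nu> (qcoeff Q g i * Q ^ i)" "0 < i \<Longrightarrow> Fin c < \<nu> (qcoeff Q g i * Q ^ i)"
    by auto
qed

text \<open>A quantitative form of the gain by a carry. Without its remainder, \<open>g\<close> has
  a leading index \<open>j \<ge> 1\<close> at weight \<open>\<epsilon>\<close>; bounding the same
  Taylor coefficient at index \<open>b * j\<close> with weight \<open>\<epsilon>0\<close> gives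
  \<open>c + nmul (b * j) (\<epsilon> - \<epsilon>0) \<le> d\<close>.\<close>

lemma qcoeff_gap:
  assumes key: "abs_key Q \<epsilon> \<gamma> b" and key0: "abs_key Q0 \<epsilon>0 \<gamma>0 b0"
    and deg: "degree Q0 = degree Q" and le: "\<epsilon>0 \<le> \<epsilon>"
    and g: "gauss_init \<epsilon> c (shift g)" and g0: "gauss_ge \<epsilon>0 c (shift g)" and i: "0 < i"
  shows "Fin (c + (\<epsilon> - \<epsilon>0)) \<le> \<nu> (qcoeff Q g i * Q ^ i)"
proof (cases "qcoeff Q g i = 0")
  case False
  have dQ: "0 < degree Q" and b: "0 < b" using key by (auto simp: abs_key_def)
  define n where "n = max i (degree g)"
  have "g = (\<Sum>i\<le>n. qcoeff Q g i * Q ^ i)"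
    by (rule qexpansion[OF dQ]) (simp add: n_def)
  also have "\<dots> = qcoeff Q g 0 + (\<Sum>i\<in>{1..n}. qcoeff Q g i * Q ^ i)"
    by (simp add: atLeast1_atMost_eq_remove0 sum.remove[of "{..n}" 0])
  finally have g_eq: "(\<Sum>i\<in>{1..n}. qcoeff Q g i * Q ^ i) = g - qcoeff Q g 0"
    by (simp add: algebra_simps)
  have ex: "\<exists>j\<in>{1..n}. \<exists>d. \<nu> (qcoeff Q g j * Q ^ j) = Fin d \<and>
      (\<forall>i\<in>{1..n}. Fin d \<le> \<nu> (qcoeff Q g i * Q ^ i)) \<and>
      (\<forall>i\<in>{1..n}. j < i \<longrightarrow> Fin d < \<nu> (qcoeff Q g i * Q ^ i)) \<and>
      gauss_top \<epsilon> d (b * j) (shift (\<Sum>i\<in>{1..n}. qcoeff Q g i * Q ^ i))"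
    by (rule ex_leading_term[OF key, of _ _ i])
      (use False i in \<open>auto simp: n_def intro: degree_qcoeff[OF dQ]\<close>)
  then obtain j d where j: "j \<in> {1..n}" "\<forall>i\<in>{1..n}. Fin d \<le> \<nu> (qcoeff Q g i * Q ^ i)"
    "gauss_top \<epsilon> d (b * j) (shift (g - qcoeff Q g 0))"
    unfolding g_eq by blast
  have "Fin c \<le> \<nu> (qcoeff Q g 0)" using gauss_init_qcoeff(1)[OF key g, of 0] by simp
  \<comment> \<open>\<open>Q0\<close> and \<open>Q\<close> have the same degree, so the remainder
    modulo \<open>Q\<close> is also small for \<open>Q0\<close>.\<close>
  then have "gauss_ge \<epsilon>0 c (shift (qcoeff Q g 0))"
    using abs_key_small[OF key0] degree_qcoeff[OF dQ] deg by (auto simp: gauss_init_def)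
  then have "Fin (c - nmul (b * j) \<epsilon>0) \<le> \<nu> (coeff (shift (g - qcoeff Q g 0)) (b * j))"
    using g0 by (auto simp: shift_diff gauss_ge_def intro: v_diff_ge)
  then have "c - nmul (b * j) \<epsilon>0 \<le> d - nmul (b * j) \<epsilon>"
    using j(3) by (auto simp: gauss_top_def)
  then have *: "c + nmul (b * j) (\<epsilon> - \<epsilon>0) \<le> d" by (simp add: nmul_minus algebra_simps)
  have "1 \<le> b * j" using b j by simp
  then have "nmul 1 (\<epsilon> - \<epsilon>0) \<le> nmul (b * j) (\<epsilon> - \<epsilon>0)"
    using le by (intro nmul_mono_left) auto
  then have "c + (\<epsilon> - \<epsilon>0) \<le> d"
    using * by (simp only: nmul_one One_nat_def) (meson add_left_mono order_trans)
  then have "Fin (c + (\<epsilon> - \<epsilon>0)) \<le> Fin d" by simp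
  also have "\<dots> \<le> \<nu> (qcoeff Q g i * Q ^ i)" using j(2) i by (auto simp: n_def)
  finally show ?thesis .
qed simp

lemma small_const_top:
  assumes "degree f = 0" "f \<noteq> 0"
  shows "\<exists>c. \<nu> f = Fin c \<and> gauss_top \<epsilon> c 0 (shift f)"
proof -
  obtain a where f: "f = [:a:]" using assms by (auto elim: degree_eq_zeroE)
  with assms obtain c where "\<nu> [:a:] = Fin c" using v_const_finite by auto
  then show ?thesis using f
    by (auto simp: shift_const gauss_top_def gauss_ge_def coeff_pCons split: nat.split)
qed

section \<open>The divisible hull \<open>Gam \<nu>\<close> as a subgroup\<close>

lemma Gam_vK: "c \<noteq> 0 \<Longrightarrow> \<nu> [:c:] = Fin g \<Longrightarrow> g \<in> Gam \<nu>"
  unfolding Gam_def vK_def by (auto intro!: exI[of _ "Suc 0"])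

lemma vK_add: "g \<in> vK \<nu> \<Longrightarrow> h \<in> vK \<nu> \<Longrightarrow> g + h \<in> vK \<nu>"
proof -
  assume "g \<in> vK \<nu>" "h \<in> vK \<nu>"
  then obtain c d where "c \<noteq> 0" "d \<noteq> 0" "\<nu> [:c:] = Fin g" "\<nu> [:d:] = Fin h"
    by (auto simp: vK_def)
  then have "c * d \<noteq> 0" "\<nu> [:c * d:] = Fin (g + h)"
    using v_mult[of "[:c:]" "[:d:]"] by (auto simp: mult.commute)
  then show ?thesis unfolding vK_def by blast
qed

lemma vK_zero: "0 \<in> vK \<nu>"
  unfolding vK_def using v_1 by (auto intro!: exI[of _ 1] simp: one_pCons)

lemma vK_uminus: "g \<in> vK \<nu> \<Longrightarrow> - g \<in> vK \<nu>"
proof -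
  assume "g \<in> vK \<nu>"
  then obtain c where c: "c \<noteq> 0" "\<nu> [:c:] = Fin g" by (auto simp: vK_def)
  have "\<nu> [:c:] + \<nu> [:inverse c:] = Fin 0"
    using v_mult[of "[:c:]" "[:inverse c:]"] c by (simp flip: one_pCons)
  then have "\<nu> [:inverse c:] = Fin (- g)"
    using c by (cases "\<nu> [:inverse c:]") (auto simp: add_eq_0_iff)
  then show ?thesis using c unfolding vK_def by (auto intro!: exI[of _ "inverse c"])
qed

lemma vK_nmul: "g \<in> vK \<nu> \<Longrightarrow> nmul n g \<in> vK \<nu>"
  by (induction n) (auto simp: vK_zero vK_add)

lemma Gam_add: assumes "g \<in> Gam \<nu>" "h \<in> Gam \<nu>" shows "g + h \<in> Gam \<nu>"
proof -
  obtain n k where n: "0 < n" "nmul n g \<in> vK \<nu>" and k: "0 < k" "nmul k h \<in> vK \<nu>"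
    using assms by (auto simp: Gam_def)
  have "nmul (k * n) (g + h) = nmul k (nmul n g) + nmul n (nmul k h)"
    by (simp add: nmul_plus nmul_mult[symmetric] mult.commute)
  then have "nmul (k * n) (g + h) \<in> vK \<nu>" using n k by (simp add: vK_add vK_nmul)
  then show ?thesis using n k by (auto simp: Gam_def intro!: exI[of _ "k * n"])
qed

lemma Gam_uminus: "g \<in> Gam \<nu> \<Longrightarrow> - g \<in> Gam \<nu>"
  using nmul_minus[of _ 0 g] vK_uminus by (auto simp: Gam_def)

lemma Gam_diff: "g \<in> Gam \<nu> \<Longrightarrow> h \<in> Gam \<nu> \<Longrightarrow> g - h \<in> Gam \<nu>"
  using Gam_add[of g "- h"] Gam_uminus by simp

lemma Gam_zero: "0 \<in> Gam \<nu>"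
  using vK_zero by (auto simp: Gam_def intro!: exI[of _ "Suc 0"])

lemma Gam_nmul: "g \<in> Gam \<nu> \<Longrightarrow> nmul n g \<in> Gam \<nu>"
  by (induction n) (auto simp: Gam_add Gam_zero)

lemma Gam_divide: "nmul n g \<in> Gam \<nu> \<Longrightarrow> 0 < n \<Longrightarrow> g \<in> Gam \<nu>"
  unfolding Gam_def by (auto simp flip: nmul_mult intro: exI[of _ "_ * n"])

end

subsection \<open>Levels and values of polynomials of small degree\<close>

locale div_pval = pval \<nu> for \<nu> :: "'k::field poly \<Rightarrow> 'g::linordered_ab_group_add extended" +
  assumes divisible: "\<forall>x::'g. \<forall>n>0. \<exists>y. nmul n y = x"
begin

text \<open>The set in the definition of the level is finite, since Taylor coefficients beyond the
  degree vanish, and nonempty by the leading one, so \<open>Max\<close> is a true maximum. It is the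
  weight of \<open>y\<close> at which the positive indices first reach the value of \<open>f\<close>
  itself.\<close>

lemma level_attained:
  assumes f: "\<nu> f = Fin a" "0 < degree f"
  shows "gauss_ge (level \<nu> f) a (shift f)"
    and "\<exists>s>0. \<nu> (coeff (shift f) s) = Fin (a - nmul s (level \<nu> f))"
proof -
  define S where "S = {gdiv (a' - b) s | s a' b. 1 \<le> s \<and> \<nu> f = Fin a' \<and> \<nu> (hasse s f) = Fin b}"
  have S_eq: "S = {gdiv (a - b) s | s b. 1 \<le> s \<and> \<nu> (coeff (shift f) s) = Fin b}"
    unfolding S_def hasse_eq_coeff_shift using f by auto
  have "S \<subseteq> (\<lambda>s. gdiv (a - the_fin (\<nu> (coeff (shift f) s))) s) ` {..degree f}"
  proof
    fix x assume "x \<in> S"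
    then obtain s b where s: "x = gdiv (a - b) s" "\<nu> (coeff (shift f) s) = Fin b"
      by (auto simp: S_eq)
    then have "s \<le> degree f"
      using coeff_eq_0[of "shift f" s] by (cases "s \<le> degree f") (auto simp: degree_shift)
    then show "x \<in> (\<lambda>s. gdiv (a - the_fin (\<nu> (coeff (shift f) s))) s) ` {..degree f}"
      using s by (intro rev_image_eqI[of s]) auto
  qed
  then have fin: "finite S" by (rule finite_subset) simp
  have "lead_coeff f \<noteq> 0" using f by auto
  then obtain b where "\<nu> (coeff (shift f) (degree f)) = Fin b"
    using v_const_finite[of "lead_coeff f"] unfolding coeff_shift_degree by blast
  then have ne: "S \<noteq> {}" using f(2) unfolding S_eq by force
  have lev: "level \<nu> f = Max S" by (simp add: level_def S_def)
  show "gauss_ge (level \<nu> f) a (shift f)"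
    unfolding gauss_ge_def
  proof
    fix s
    show "Fin (a - nmul s (level \<nu> f)) \<le> \<nu> (coeff (shift f) s)"
    proof (cases "s = 0")
      case False
      show ?thesis
      proof (cases "\<nu> (coeff (shift f) s)")
        case (Fin b)
        then have "gdiv (a - b) s \<in> S" using False unfolding S_eq by force
        then have "gdiv (a - b) s \<le> level \<nu> f" using fin lev by simp
        then have "nmul s (gdiv (a - b) s) \<le> nmul s (level \<nu> f)" by (rule nmul_mono)
        then have "a - b \<le> nmul s (level \<nu> f)" using nmul_gdiv[OF divisible] False by simp
        then show ?thesis using Fin by (simp add: algebra_simps)
      qed auto
    qed (use f in simp)
  qed
  have "level \<nu> f \<in> S" unfolding lev using fin ne by (rule Max_in)
  then obtain s b where s: "1 \<le> s" "level \<nu> f = gdiv (a - b) s" "\<nu> (coeff (shift f) s) = Fin b"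
    by (auto simp: S_eq)
  then have "nmul s (level \<nu> f) = a - b" using nmul_gdiv[OF divisible] by simp
  then show "\<exists>s>0. \<nu> (coeff (shift f) s) = Fin (a - nmul s (level \<nu> f))"
    using s by (intro exI[of _ s]) auto
qed

text \<open>Here \<open>b\<close> is the largest index at which the maximum defining the level is
  attained.\<close>

lemma level_gauss_top:
  assumes f: "\<nu> f = Fin a" "0 < degree f"
  shows "\<exists>b>0. gauss_top (level \<nu> f) a b (shift f)"
proof -
  let ?S = "{s. s > 0 \<and> \<nu> (coeff (shift f) s) = Fin (a - nmul s (level \<nu> f))}"
  have "s \<le> degree f" if "s \<in> ?S" for s
    using that coeff_eq_0[of "shift f" s] by (cases "s \<le> degree f") (auto simp: degree_shift)
  then have fin: "finite ?S" by (meson finite_nat_set_iff_bounded_le)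
  have "?S \<noteq> {}" using level_attained(2)[OF f] by auto
  then have b: "Max ?S \<in> ?S" using fin by (rule Max_in[rotated])
  have "Fin (a - nmul s (level \<nu> f)) < \<nu> (coeff (shift f) s)" if "Max ?S < s" for s
  proof -
    have "s \<notin> ?S" using that fin by (meson Max_ge not_le)
    moreover have "0 < s" using that by simp
    ultimately have "\<nu> (coeff (shift f) s) \<noteq> Fin (a - nmul s (level \<nu> f))" by simp
    then show ?thesis using level_attained(1)[OF f] by (auto simp: gauss_ge_def order_less_le)
  qed
  then have "gauss_top (level \<nu> f) a (Max ?S) (shift f)"
    using b level_attained(1)[OF f] by (auto simp: gauss_top_def)
  then show ?thesis using b by blast
qed

lemma gauss_top_of_level_less:
  assumes f: "\<nu> f = Fin a" "0 < degree f" and less: "level \<nu> f < \<epsilon>"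
  shows "gauss_top \<epsilon> a 0 (shift f)"
proof -
  have "Fin (a - nmul s \<epsilon>) < \<nu> (coeff (shift f) s)" if "0 < s" for s
  proof (rule Fin_less_le_mono)
    show "a - nmul s \<epsilon> < a - nmul s (level \<nu> f)"
      using nmul_strict_mono[OF less that] by simp
  qed (use level_attained(1)[OF f] in \<open>auto simp: gauss_ge_def\<close>)
  moreover have "\<nu> (coeff (shift f) 0) = Fin (a - nmul 0 \<epsilon>)" using f by simp
  ultimately show ?thesis unfolding gauss_top_def gauss_ge_def
    by (metis less_imp_le neq0_conv order_refl)
qed

lemma gauss_ge_of_level_le:
  assumes f: "\<nu> f = Fin a" "0 < degree f" and le: "level \<nu> f \<le> \<epsilon>"
  shows "gauss_ge \<epsilon> a (shift f)"
  unfolding gauss_ge_def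
proof
  fix s
  have "a - nmul s \<epsilon> \<le> a - nmul s (level \<nu> f)" using nmul_mono[OF le] by simp
  then show "Fin (a - nmul s \<epsilon>) \<le> \<nu> (coeff (shift f) s)"
    by (rule Fin_le_mono) (use level_attained(1)[OF f] in \<open>auto simp: gauss_ge_def\<close>)
qed

text \<open>Smaller level means that at the weight \<open>level \<nu> f\<close> only the constant
  Taylor coefficient is minimal. The leading coefficient of \<open>f\<close> is arbitrary, as
  required for the polynomial of minimal degree chosen in the next proof.\<close>

lemma abs_key_level:
  assumes f: "\<nu> f = Fin a" "0 < degree f"
    and min: "\<And>g. 0 < degree g \<Longrightarrow> degree g < degree f \<Longrightarrow> \<nu> g \<noteq> Pinf \<and> level \<nu> g < level \<nu> f"
  shows "\<exists>b. abs_key f (level \<nu> f) a b"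
proof -
  obtain b where b: "0 < b" "gauss_top (level \<nu> f) a b (shift f)"
    using level_gauss_top[OF f] by blast
  have "\<exists>c. \<nu> g = Fin c \<and> gauss_top (level \<nu> f) c 0 (shift g)"
    if "g \<noteq> 0" "degree g < degree f" for g
  proof (cases "degree g = 0")
    case True
    then show ?thesis using small_const_top that by simp
  next
    case False
    then have g: "\<nu> g \<noteq> Pinf" "level \<nu> g < level \<nu> f" using min[of g] that by auto
    then obtain c where "\<nu> g = Fin c" by (cases "\<nu> g") auto
    then show ?thesis using gauss_top_of_level_less g False by auto
  qed
  then show ?thesis using b f by (auto simp: abs_key_def)
qed

lemma key_poly_abs_key:
  assumes "key_poly \<nu> Q"
  obtains \<gamma> b where "\<nu> Q = Fin \<gamma>" "abs_key Q (level \<nu> Q) \<gamma> b"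
proof -
  obtain \<gamma> where "\<nu> Q = Fin \<gamma>" using assms by (cases "\<nu> Q") (auto simp: key_poly_def)
  moreover from this have "\<exists>b. abs_key Q (level \<nu> Q) \<gamma> b"
    using assms by (intro abs_key_level) (auto simp: key_poly_def)
  ultimately show ?thesis using that by blast
qed

text \<open>If the value \<open>c\<close> of a polynomial \<open>f\<close> of minimal degree were outside \<open>Gam \<nu>\<close>, then \<open>f\<close> would have
  the largest level of all polynomials, since the terms of an \<open>f\<close>-expansion have pairwise
  distinct values.\<close>

lemma key_poly_small_value_in_Gam:
  assumes key: "key_poly \<nu> Q" and "f \<noteq> 0" "degree f < degree Q"
  shows "\<exists>c\<in>Gam \<nu>. \<nu> f = Fin c"
  using assms(2,3)
proof (induction "degree f" arbitrary: f rule: less_induct)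
  case less
  obtain \<gamma> b where Q: "\<nu> Q = Fin \<gamma>" "abs_key Q (level \<nu> Q) \<gamma> b"
    using key by (rule key_poly_abs_key)
  have small: "\<exists>c. \<nu> g = Fin c" if "g \<noteq> 0" "degree g < degree Q" for g
    using Q(2) that unfolding abs_key_def by blast
  have lev: "level \<nu> g < level \<nu> Q" if "0 < degree g" "degree g < degree Q" for g
    using key that by (auto simp: key_poly_def)
  obtain c where c: "\<nu> f = Fin c" using small less.prems by blast
  have "c \<in> Gam \<nu>"
  proof (rule ccontr)
    assume nG: "c \<notin> Gam \<nu>"
    have f0: "0 < degree f"
    proof (rule ccontr)
      assume "\<not> 0 < degree f"
      then obtain a where "f = [:a:]" by (auto elim: degree_eq_zeroE)
      then show False using nG c less.prems Gam_vK[of a] by auto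
    qed
    \<comment> \<open>No polynomial of degree below that of \<open>f\<close> has larger level than
      \<open>f\<close>.\<close>
    have ge: "gauss_ge (level \<nu> f) d (shift g)"
      if g: "g \<noteq> 0" "degree g < degree f" "\<nu> g = Fin d" for g d
    proof (cases "degree g = 0")
      case True
      then show ?thesis using small_const_top[of g "level \<nu> f"] g by (auto simp: gauss_top_def)
    next
      case False
      have "level \<nu> g \<le> level \<nu> f"
      proof (rule ccontr)
        assume "\<not> level \<nu> g \<le> level \<nu> f"
        \<comment> \<open>A counterexample \<open>h\<close> of minimal degree satisfies
          \<open>abs_key\<close>. In the \<open>h\<close>-expansion of \<open>f\<close> some term
          has value exactly \<open>c\<close>, and by induction that value lies in
          \<open>Gam \<nu>\<close>.\<close>
        then have "\<exists>g. 0 < degree g \<and> degree g < degree f \<and> level \<nu> f < level \<nu> g"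
          using g False by auto
        then obtain h where h: "0 < degree h" "degree h < degree f" "level \<nu> f < level \<nu> h"
          and hmin: "\<And>g. 0 < degree g \<and> degree g < degree f \<and> level \<nu> f < level \<nu> g \<Longrightarrow>
            degree h \<le> degree g"
          using ex_has_least_nat[of "\<lambda>g. 0 < degree g \<and> degree g < degree f \<and> level \<nu> f < level \<nu> g"
              _ degree] by metis
        have h0: "h \<noteq> 0" using h by auto
        then obtain e where e: "\<nu> h = Fin e" "e \<in> Gam \<nu>" using less.hyps[of h] h less.prems by auto
        have "\<exists>b. abs_key h (level \<nu> h) e b"
        proof (rule abs_key_level[OF e(1) h(1)])
          fix g :: "'k poly" assume g: "0 < degree g" "degree g < degree h"
          then have "\<not> level \<nu> f < level \<nu> g" using hmin[of g] h by auto
          moreover have "g \<noteq> 0" using g by auto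
          then have "\<nu> g \<noteq> Pinf" using small[of g] g h less.prems by auto
          ultimately show "\<nu> g \<noteq> Pinf \<and> level \<nu> g < level \<nu> h" using h by auto
        qed
        then obtain b' where key_h: "abs_key h (level \<nu> h) e b'" by blast
        have "gauss_top (level \<nu> h) c 0 (shift f)"
          using c f0 h by (intro gauss_top_of_level_less)
        then have "gauss_init (level \<nu> h) c (shift f)" by (auto simp: gauss_top_def gauss_init_def)
        then have ge: "Fin c \<le> \<nu> (qcoeff h f i * h ^ i)" for i
          by (rule gauss_init_qcoeff(1)[OF key_h])
        have "\<exists>i. \<nu> (qcoeff h f i * h ^ i) = Fin c"
        proof (rule ccontr)
          assume "\<not> ?thesis"
          then have "Fin c < \<nu> (qcoeff h f i * h ^ i)" for i
            using ge[of i] by (auto simp: order_less_le)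
          then have "Fin c < \<nu> (\<Sum>i\<le>degree f. qcoeff h f i * h ^ i)" by (intro v_sum_gt)
          then show False using qexpansion[OF h(1), of f "degree f"] c by simp
        qed
        then obtain i where i: "\<nu> (qcoeff h f i * h ^ i) = Fin c" by blast
        have "qcoeff h f i \<noteq> 0" using i by auto
        moreover have "degree (qcoeff h f i) < degree h" using degree_qcoeff h by blast
        ultimately obtain d where "d \<in> Gam \<nu>" "\<nu> (qcoeff h f i) = Fin d"
          using less.hyps[of "qcoeff h f i"] h less.prems by auto
        then have "c \<in> Gam \<nu>" using i e by (auto simp: v_mult v_power intro: Gam_add Gam_nmul)
        then show False using nG by simp
      qed
      then show ?thesis using g False by (intro gauss_ge_of_level_le) auto
    qed
    let ?q = "qcoeff f Q" let ?A = "{i. i \<le> degree Q \<and> ?q i \<noteq> 0}"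
    have q: "\<exists>d. d \<in> Gam \<nu> \<and> \<nu> (?q i) = Fin d" if "?q i \<noteq> 0" for i
      using less.hyps[of "?q i"] degree_qcoeff[OF f0, of Q i] less.prems that by auto
    have "Q = (\<Sum>i\<le>degree Q. ?q i * f ^ i)" using f0 by (rule qexpansion) simp
    also have "\<dots> = (\<Sum>i\<in>?A. ?q i * f ^ i)" by (rule sum.mono_neutral_right) auto
    finally have Q_eq: "Q = (\<Sum>i\<in>?A. ?q i * f ^ i)" .
    have Ane: "?A \<noteq> {}"
    proof
      assume "?A = {}"
      then have "Q = 0" using Q_eq by (metis sum.empty)
      then show False using Q(1) by simp
    qed
    obtain j where j: "j \<in> ?A" "\<forall>i\<in>?A. \<nu> (?q j * f ^ j) \<le> \<nu> (?q i * f ^ i)"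
      using ex_last_minimizer[of ?A "\<lambda>i. \<nu> (?q i * f ^ i)"] Ane by auto
    \<comment> \<open>A coincidence would put a positive multiple of \<open>c\<close> into
      \<open>Gam \<nu>\<close>, hence \<open>c\<close> itself.\<close>
    have neq: "\<nu> (?q i * f ^ i) \<noteq> \<nu> (?q k * f ^ k)" if ik: "i \<in> ?A" "k \<in> ?A" "i < k" for i k
    proof
      assume eq: "\<nu> (?q i * f ^ i) = \<nu> (?q k * f ^ k)"
      obtain d d' where d: "d \<in> Gam \<nu>" "\<nu> (?q i) = Fin d" "d' \<in> Gam \<nu>" "\<nu> (?q k) = Fin d'"
        using q[of i] q[of k] ik by auto
      have "d + nmul i c = d' + nmul k c" using eq d c by (simp add: v_mult v_power)
      moreover have "nmul k c = nmul i c + nmul (k - i) c"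
        using nmul_add[of i "k - i" c] ik by simp
      ultimately have "nmul (k - i) c = d - d'" by (simp add: algebra_simps)
      then have "nmul (k - i) c \<in> Gam \<nu>" using d Gam_diff by simp
      then show False using nG Gam_divide ik by auto
    qed
    obtain d where d: "\<nu> (?q j) = Fin d" using q j by blast
    define e where "e = d + nmul j c"
    have e: "\<nu> (?q j * f ^ j) = Fin e" using d c by (simp add: v_mult v_power e_def)
    have "Fin e < \<nu> (?q i * f ^ i)" if "i \<in> ?A" "i \<noteq> j" for i
      using j that neq[of i j] neq[of j i] e by (metis (no_types, lifting) linorder_neqE_nat order_less_le)
    then have "\<nu> (\<Sum>i\<in>?A. ?q i * f ^ i) = Fin e" using j e by (intro v_sum_eq[of _ j]) auto
    then have "e = \<gamma>" using Q(1) Q_eq by simp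
    have "gauss_ge (level \<nu> f) \<gamma> (shift (?q i * f ^ i))" if i: "i \<in> ?A" for i
    proof -
      obtain d where d: "\<nu> (?q i) = Fin d" using q i by blast
      have "gauss_ge (level \<nu> f) d (shift (?q i))"
        using i d degree_qcoeff[OF f0] by (intro ge) auto
      moreover have "gauss_ge (level \<nu> f) (nmul i c) (shift f ^ i)"
        using level_attained(1)[OF c f0] by (rule gauss_ge_power)
      ultimately have "gauss_ge (level \<nu> f) (d + nmul i c) (shift (?q i * f ^ i))"
        unfolding shift_mult shift_power by (rule gauss_ge_mult)
      moreover have "\<gamma> \<le> d + nmul i c"
        using j(2) i e d c \<open>e = \<gamma>\<close>
        by (auto simp: v_mult v_power dest!: bspec[of _ _ i])
      ultimately show ?thesis by (rule gauss_ge_mono)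
    qed
    then have "gauss_ge (level \<nu> f) \<gamma> (shift (\<Sum>i\<in>?A. ?q i * f ^ i))"
      unfolding shift_sum by (rule gauss_ge_sum)
    then have "gauss_ge (level \<nu> f) \<gamma> (shift Q)" using Q_eq by simp
    \<comment> \<open>At index \<open>b\<close> the value is exactly
      \<open>\<gamma> - nmul b (level \<nu> Q)\<close>, so the level of \<open>Q\<close> cannot
      exceed that of \<open>f\<close>.\<close>
    then have "Fin (\<gamma> - nmul b (level \<nu> f)) \<le> \<nu> (coeff (shift Q) b)"
      by (auto simp: gauss_ge_def)
    then have "nmul b (level \<nu> Q) \<le> nmul b (level \<nu> f)" "0 < b"
      using Q(2) by (auto simp: abs_key_def gauss_top_def)
    then have "level \<nu> Q \<le> level \<nu> f" by (simp add: nmul_le_cancel)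
    then show False using lev[of f] f0 less.prems by simp
  qed
  then show ?case using c by blast
qed

end

subsection \<open>Families of key polynomials of the same degree\<close>

text \<open>Substitute \<open>Q = R + (Q - R)\<close> in the \<open>Q\<close>-expansion and expand
  binomially. The product in front of \<open>R ^ k\<close> may have degree at least that of
  \<open>R\<close>; its digit of index \<open>j - k\<close> is what it carries to place
  \<open>j\<close>.\<close>

lemma qcoeff_change_base:
  fixes f Q R :: "'k::field poly"
  assumes "0 < degree Q" "0 < degree R" "degree f \<le> n"
  shows "qcoeff R f j = (\<Sum>i\<le>n. \<Sum>k\<le>i. if k \<le> j
    then qcoeff R (of_nat (i choose k) * qcoeff Q f i * (Q - R) ^ (i - k)) (j - k) else 0)"
proof -
  let ?E = "\<lambda>i k. of_nat (i choose k) * qcoeff Q f i * (Q - R) ^ (i - k)"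
  have pw: "qcoeff Q f i * Q ^ i = (\<Sum>k\<le>i. ?E i k * R ^ k)" for i
    using binomial_ring[of R "Q - R" i] by (simp add: sum_distrib_left algebra_simps)
  have "f = (\<Sum>i\<le>n. qcoeff Q f i * Q ^ i)" using assms by (intro qexpansion)
  also have "\<dots> = (\<Sum>i\<le>n. \<Sum>k\<le>i. ?E i k * R ^ k)" by (simp only: pw)
  finally have "qcoeff R f j = qcoeff R (\<Sum>i\<le>n. \<Sum>k\<le>i. ?E i k * R ^ k) j" by simp
  also have "\<dots> = (\<Sum>i\<le>n. \<Sum>k\<le>i. qcoeff R (?E i k * R ^ k) j)" by (simp only: qcoeff_sum)
  also have "\<dots> = (\<Sum>i\<le>n. \<Sum>k\<le>i. if k \<le> j then qcoeff R (?E i k) (j - k) else 0)"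
    by (intro sum.cong refl) (use assms(2) in \<open>subst qcoeff_mult_power; auto\<close>)
  finally show ?thesis .
qed

lemma nuQ_le_iff:
  assumes "0 < degree Q" "\<nu> 0 = Pinf"
  shows "x \<le> nuQ \<nu> Q f \<longleftrightarrow> (\<forall>i. x \<le> \<nu> (qcoeff Q f i * Q ^ i))"
proof -
  have "{\<nu> (qcoeff Q f i * Q ^ i) | i. i \<le> degree f} = (\<lambda>i. \<nu> (qcoeff Q f i * Q ^ i)) ` {..degree f}"
    by auto
  then have "x \<le> nuQ \<nu> Q f \<longleftrightarrow> (\<forall>i\<le>degree f. x \<le> \<nu> (qcoeff Q f i * Q ^ i))"
    unfolding nuQ_def by auto
  moreover have "x \<le> \<nu> (qcoeff Q f i * Q ^ i)" if "degree f < i" for i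
  proof -
    have "degree f < i * degree Q" using that assms(1) by (metis One_nat_def Suc_leI le_trans less_le_trans mult.right_neutral mult_le_mono2)
    then show ?thesis using assms(2) by (simp add: qcoeff_eq_0)
  qed
  ultimately show ?thesis by (meson not_le)
qed

locale key_family = div_pval \<nu> for \<nu> :: "'k::field poly \<Rightarrow> 'g::linordered_ab_group_add extended" +
  fixes m :: nat and QQ :: "'k poly set"
  assumes m: "1 \<le> m"
    and QQ_ne: "QQ \<noteq> {}"
    and QQ_sub: "QQ \<subseteq> Psi \<nu> m"
    and QQ_inj: "inj_on \<nu> QQ"
    and QQ_nomax: "\<forall>Q\<in>QQ. \<exists>R\<in>QQ. \<nu> Q < \<nu> R"
begin

abbreviation "\<gamma> Q \<equiv> the_fin (\<nu> Q)"

lemma QQ_degree: "Q \<in> QQ \<Longrightarrow> degree Q = m" and QQ_key: "Q \<in> QQ \<Longrightarrow> key_poly \<nu> Q"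
  using QQ_sub by (auto simp: Psi_def)

lemma QQ_degree_pos: "Q \<in> QQ \<Longrightarrow> 0 < degree Q"
  using QQ_degree m by force

lemma QQ_value: assumes "Q \<in> QQ" shows "\<nu> Q = Fin (\<gamma> Q)"
  using QQ_key[OF assms] by (cases "\<nu> Q") (auto simp: key_poly_def)

lemma QQ_abs_key:
  assumes "Q \<in> QQ" obtains b where "abs_key Q (level \<nu> Q) (\<gamma> Q) b"
  using key_poly_abs_key[OF QQ_key[OF assms]] by (metis the_fin.simps(1))

lemma QQ_le_iff: "Q \<in> QQ \<Longrightarrow> R \<in> QQ \<Longrightarrow> \<nu> Q \<le> \<nu> R \<longleftrightarrow> \<gamma> Q \<le> \<gamma> R"
  using QQ_value by (metis less_eq_extended.simps(1))

lemma QQ_eqI: "Q \<in> QQ \<Longrightarrow> R \<in> QQ \<Longrightarrow> \<gamma> Q = \<gamma> R \<Longrightarrow> Q = R"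
  using QQ_inj QQ_value by (metis inj_onD)

lemma QQ_greater: assumes "Q \<in> QQ" obtains R where "R \<in> QQ" "\<gamma> Q < \<gamma> R"
  using assms QQ_nomax QQ_value by (metis less_extended_simps(1))

lemma QQ_greater2:
  assumes "Q \<in> QQ" "R \<in> QQ" obtains S where "S \<in> QQ" "\<gamma> Q < \<gamma> S" "\<gamma> R < \<gamma> S"
  using assms QQ_greater by (metis (full_types) linorder_le_cases order_le_less_trans)

lemma ev_iff: "ev \<nu> QQ P \<longleftrightarrow> (\<exists>Q\<in>QQ. \<forall>R\<in>QQ. \<gamma> Q \<le> \<gamma> R \<longrightarrow> P R)"
  unfolding ev_def using QQ_le_iff by (metis (no_types, lifting))

lemma ev_conj: assumes "ev \<nu> QQ P" "ev \<nu> QQ P'" shows "ev \<nu> QQ (\<lambda>Q. P Q \<and> P' Q)"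
proof -
  obtain Q Q' where Q: "Q \<in> QQ" "\<forall>R\<in>QQ. \<gamma> Q \<le> \<gamma> R \<longrightarrow> P R"
    "Q' \<in> QQ" "\<forall>R\<in>QQ. \<gamma> Q' \<le> \<gamma> R \<longrightarrow> P' R" using assms unfolding ev_iff by blast
  obtain S where "S \<in> QQ" "\<gamma> Q < \<gamma> S" "\<gamma> Q' < \<gamma> S" using QQ_greater2 Q by metis
  then show ?thesis unfolding ev_iff using Q by (intro bexI[of _ S]) auto
qed

lemma ev_ball:
  assumes "finite A" "\<And>i. i \<in> A \<Longrightarrow> ev \<nu> QQ (P i)"
  shows "ev \<nu> QQ (\<lambda>Q. \<forall>i\<in>A. P i Q)"
  using assms
proof (induction A rule: finite_induct)
  case empty
  then show ?case using QQ_ne by (auto simp: ev_def)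
next
  case (insert i A)
  then have "ev \<nu> QQ (\<lambda>Q. P i Q \<and> (\<forall>i\<in>A. P i Q))" by (intro ev_conj) auto
  then show ?case by simp
qed

lemma small_value:
  assumes "f \<noteq> 0" "degree f < m" obtains c where "\<nu> f = Fin c" "c \<in> Gam \<nu>"
  using QQ_ne QQ_key QQ_degree key_poly_small_value_in_Gam assms by (metis all_not_in_conv)

lemma degree_QQ_diff:
  assumes "Q \<in> QQ" "R \<in> QQ" shows "degree (Q - R) < m"
proof -
  have "degree (Q - R) \<le> m" using QQ_degree assms by (intro degree_diff_le) auto
  moreover have "coeff (Q - R) m = 0"
    using QQ_degree QQ_key assms by (metis cancel_comm_monoid_add_class.diff_cancel coeff_diff key_poly_def)
  ultimately show ?thesis
    using m by (metis One_nat_def degree_0 leading_coeff_0_iff not_le not_less_eq_eq le_zero_eq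
        nat_less_le zero_le)
qed

lemma value_QQ_diff:
  assumes "Q \<in> QQ" "R \<in> QQ" "\<gamma> Q < \<gamma> R"
  shows "\<nu> (Q - R) = Fin (\<gamma> Q)" "\<nu> (R - Q) = Fin (\<gamma> Q)"
proof -
  have "\<nu> Q < \<nu> (- R)" using assms by (metis QQ_value less_extended_simps(1) v_uminus)
  then have "\<nu> (Q - R) = \<nu> Q" using v_add_eq[of Q "- R"] by simp
  then show "\<nu> (Q - R) = Fin (\<gamma> Q)" using assms QQ_value by simp
  then show "\<nu> (R - Q) = Fin (\<gamma> Q)" using v_uminus[of "Q - R"] by simp
qed

text \<open>The value of \<open>Q\<close> is also that of \<open>Q - R\<close> for a larger
  \<open>R\<close>, and this difference has degree below \<open>m\<close>.\<close>

lemma QQ_value_Gam: assumes "Q \<in> QQ" shows "\<gamma> Q \<in> Gam \<nu>"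
proof -
  obtain R where R: "R \<in> QQ" "\<gamma> Q < \<gamma> R" using QQ_greater assms by blast
  have "Q - R \<noteq> 0" using R by auto
  then show ?thesis using value_QQ_diff(1)[OF assms R] degree_QQ_diff[OF assms R(1)]
    by (metis extended.inject small_value)
qed

section \<open>Carries and change of base within the family\<close>

text \<open>These are the products met in a change of base: a binomial coefficient, a digit, and a
  power of a difference of two key polynomials. Each factor has an initial form constant in
  \<open>y\<close>, and so does the product.\<close>

lemma product_gauss_init:
  assumes "Q \<in> QQ" "degree g < m" "degree a < m" "Fin c \<le> \<nu> g" "Fin d \<le> \<nu> a"
  shows "gauss_init (level \<nu> Q) (c + nmul n d) (shift (of_nat N * g * a ^ n))"
proof -
  obtain b where key: "abs_key Q (level \<nu> Q) (\<gamma> Q) b" using QQ_abs_key assms by blast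
  note small = abs_key_small[OF key, unfolded QQ_degree[OF assms(1)]]
  have "gauss_init (level \<nu> Q) 0 (shift (of_nat N))"
    using small[of "of_nat N" 0] m v_of_nat by simp
  from gauss_init_mult[OF gauss_init_mult[OF this small[OF assms(2,4)]]
      gauss_init_power[OF small[OF assms(3,5)], of n]]
  show ?thesis by (simp add: shift_mult shift_power)
qed

lemma product_qcoeff:
  assumes "Q \<in> QQ" "degree g < m" "degree a < m" "Fin c \<le> \<nu> g" "Fin d \<le> \<nu> a"
  shows "Fin (c + nmul n d - nmul t (\<gamma> Q)) \<le> \<nu> (qcoeff Q (of_nat N * g * a ^ n) t)"
    and "0 < t \<Longrightarrow> Fin (c + nmul n d - nmul t (\<gamma> Q)) < \<nu> (qcoeff Q (of_nat N * g * a ^ n) t)"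
proof -
  obtain b where key: "abs_key Q (level \<nu> Q) (\<gamma> Q) b" using QQ_abs_key assms by blast
  note gauss_init_qcoeff[OF key product_gauss_init[OF assms]]
  then show "Fin (c + nmul n d - nmul t (\<gamma> Q)) \<le> \<nu> (qcoeff Q (of_nat N * g * a ^ n) t)"
    "0 < t \<Longrightarrow> Fin (c + nmul n d - nmul t (\<gamma> Q)) < \<nu> (qcoeff Q (of_nat N * g * a ^ n) t)"
    using QQ_value[OF assms(1)] by (auto simp: v_mult_power_le_iff v_mult_power_less_iff)
qed

text \<open>The \<open>n + 1\<close> factors of degree at most \<open>m - 1\<close> have total
  degree below \<open>(n + 1) * m\<close>, so at most \<open>n\<close> places are carried.\<close>

lemma product_qcoeff_eq_0:
  assumes "Q \<in> QQ" "degree g < m" "degree a < m" "n < t"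
  shows "qcoeff Q (of_nat N * g * a ^ n) t = 0"
proof (rule qcoeff_eq_0)
  have "degree (a ^ n) \<le> n * (m - 1)"
    using degree_power_le[of a n] assms(3)
    by (metis Suc_diff_1 bot_nat_0.not_eq_extremum less_Suc_eq_le less_nat_zero_code mult.commute
        mult_le_mono2 order_trans)
  moreover have "degree (of_nat N * g * a ^ n) \<le> degree g + degree (a ^ n)"
    using degree_mult_le[of "of_nat N * g" "a ^ n"] degree_mult_le[of "of_nat N" g] by simp
  ultimately have "degree (of_nat N * g * a ^ n) \<le> (m - 1) + n * (m - 1)"
    using assms(2) by linarith
  also have "\<dots> = Suc n * (m - 1)" by simp
  also have "\<dots> < Suc n * m" using m by (intro mult_less_mono2) auto
  also have "\<dots> \<le> t * m" using assms(4) by (intro mult_le_mono1) simp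
  finally show "degree (of_nat N * g * a ^ n) < t * degree Q" using QQ_degree[OF assms(1)] by simp
qed

lemma degree_QQ_qcoeff: "Q \<in> QQ \<Longrightarrow> degree (qcoeff Q f i) < m"
  using degree_qcoeff QQ_degree QQ_degree_pos by metis

text \<open>In the change of base from \<open>Q\<close> to \<open>R\<close> a factor
  \<open>Q\<close> becomes either \<open>Q - R\<close>, of the same value, or \<open>R\<close>, of
  larger value, and carries lose nothing.\<close>

lemma qcoeff_value_mono:
  assumes Q: "Q \<in> QQ" "R \<in> QQ" "\<gamma> Q < \<gamma> R"
    and c: "\<And>i. Fin c \<le> \<nu> (qcoeff Q f i * Q ^ i)"
  shows "Fin c \<le> \<nu> (qcoeff R f j * R ^ j)" "0 < j \<Longrightarrow> Fin c < \<nu> (qcoeff R f j * R ^ j)"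
proof -
  let ?T = "\<lambda>i k. if k \<le> j
    then qcoeff R (of_nat (i choose k) * qcoeff Q f i * (Q - R) ^ (i - k)) (j - k) else 0"
  have exp: "qcoeff R f j = (\<Sum>i\<le>degree f. \<Sum>k\<le>i. ?T i k)"
    using Q by (intro qcoeff_change_base) (auto simp: QQ_degree_pos)
  have cq: "Fin (c - nmul i (\<gamma> Q)) \<le> \<nu> (qcoeff Q f i)" for i
    using c v_mult_power_le_iff QQ_value Q by blast
  have weight: "c - nmul i (\<gamma> Q) + nmul (i - k) (\<gamma> Q) - nmul (j - k) (\<gamma> R)
      = c - nmul j (\<gamma> R) + nmul k (\<gamma> R - \<gamma> Q)" if "k \<le> i" "k \<le> j" for i k
    using nmul_add[of k "i - k" "\<gamma> Q"] nmul_add[of k "j - k" "\<gamma> R"] that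
    by (simp add: nmul_minus algebra_simps)
  note pq = product_qcoeff[OF Q(2) degree_QQ_qcoeff[OF Q(1)] degree_QQ_diff[OF Q(1,2)] cq
      eq_refl[OF value_QQ_diff(1)[OF Q, symmetric]]]
  have "Fin (c - nmul j (\<gamma> R)) \<le> \<nu> (?T i k)" if "k \<le> i" for i k
  proof (cases "k \<le> j")
    case True
    have "0 \<le> nmul k (\<gamma> R - \<gamma> Q)" using Q(3) by (intro nmul_nonneg) simp
    then show ?thesis
      using Fin_le_mono[OF _ pq(1)[of i "i - k" "j - k" "i choose k", unfolded weight[OF that True]]] True
      by simp
  qed simp
  then have "Fin (c - nmul j (\<gamma> R)) \<le> \<nu> (qcoeff R f j)"
    unfolding exp by (intro v_sum_ge) auto
  then show "Fin c \<le> \<nu> (qcoeff R f j * R ^ j)" using QQ_value[OF Q(2)] by (simp add: v_mult_power_le_iff)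
  assume j: "0 < j"
  have "Fin (c - nmul j (\<gamma> R)) < \<nu> (?T i k)" if "k \<le> i" for i k
  proof (cases "k \<le> j")
    case True
    show ?thesis
    \<comment> \<open>For \<open>k < j\<close> strictness comes from a carry, for
      \<open>k = j > 0\<close> from the factor \<open>R ^ j\<close>.\<close>
    proof (cases "k = j")
      case False
      have "0 \<le> nmul k (\<gamma> R - \<gamma> Q)" using Q(3) by (intro nmul_nonneg) simp
      then show ?thesis
        using Fin_less_mono[OF _ pq(2)[of "j - k" i "i - k" "i choose k", unfolded weight[OF that True]]]
          True False by simp
    next
      case kj: True
      have "0 < nmul k (\<gamma> R - \<gamma> Q)" using nmul_strict_mono[of 0 "\<gamma> R - \<gamma> Q" k] Q(3) j kj by simp
      then show ?thesis
        using Fin_less_le_mono[OF _ pq(1)[of i "i - k" "j - k" "i choose k", unfolded weight[OF that True]]]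
          True by simp
    qed
  qed simp
  then have "Fin (c - nmul j (\<gamma> R)) < \<nu> (qcoeff R f j)"
    unfolding exp by (intro v_sum_gt) auto
  then show "Fin c < \<nu> (qcoeff R f j * R ^ j)" using QQ_value[OF Q(2)] by (simp add: v_mult_power_less_iff)
qed

lemma QQ_nuQ_le_iff: "Q \<in> QQ \<Longrightarrow> x \<le> nuQ \<nu> Q f \<longleftrightarrow> (\<forall>i. x \<le> \<nu> (qcoeff Q f i * Q ^ i))"
  by (intro nuQ_le_iff) (auto simp: QQ_degree_pos)

lemma nuQ_mono:
  assumes "Q \<in> QQ" "R \<in> QQ" "\<gamma> Q \<le> \<gamma> R" "Fin c \<le> nuQ \<nu> Q f"
  shows "Fin c \<le> nuQ \<nu> R f"
  using assms qcoeff_value_mono(1)[of Q R c f] QQ_eqI[of Q R]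
  by (cases "\<gamma> Q = \<gamma> R") (auto simp: QQ_nuQ_le_iff)

text \<open>The converse substitution replaces each factor \<open>R\<close> by \<open>Q\<close> or
  \<open>R - Q\<close>, both of value \<open>\<gamma> Q\<close>. At most \<open>n\<close> factors
  occur, each losing \<open>\<gamma> R - \<gamma> Q\<close>.\<close>

lemma nuQ_growth:
  assumes Q: "Q \<in> QQ" "R \<in> QQ" "\<gamma> Q < \<gamma> R" and n: "degree f \<le> n"
    and c: "Fin c \<le> nuQ \<nu> R f"
  shows "Fin (c - nmul n (\<gamma> R - \<gamma> Q)) \<le> nuQ \<nu> Q f"
  unfolding QQ_nuQ_le_iff[OF Q(1)]
proof
  fix j
  let ?T = "\<lambda>i k. if k \<le> j
    then qcoeff Q (of_nat (i choose k) * qcoeff R f i * (R - Q) ^ (i - k)) (j - k) else 0"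
  let ?c = "c - nmul n (\<gamma> R - \<gamma> Q)"
  have exp: "qcoeff Q f j = (\<Sum>i\<le>n. \<Sum>k\<le>i. ?T i k)"
    using Q n by (intro qcoeff_change_base) (auto simp: QQ_degree_pos)
  have cq: "Fin (c - nmul i (\<gamma> R)) \<le> \<nu> (qcoeff R f i)" for i
    using c v_mult_power_le_iff QQ_value QQ_nuQ_le_iff Q(2) by blast
  have weight: "c - nmul i (\<gamma> R) + nmul (i - k) (\<gamma> Q) - nmul (j - k) (\<gamma> Q)
      = c - nmul i (\<gamma> R - \<gamma> Q) - nmul j (\<gamma> Q)" if "k \<le> i" "k \<le> j" for i k
    using nmul_add[of k "i - k" "\<gamma> Q"] nmul_add[of k "j - k" "\<gamma> Q"] that
    by (simp add: nmul_minus algebra_simps)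
  note pq = product_qcoeff[OF Q(1) degree_QQ_qcoeff[OF Q(2)] degree_QQ_diff[OF Q(2,1)] cq
      eq_refl[OF value_QQ_diff(2)[OF Q, symmetric]]]
  have "Fin (?c - nmul j (\<gamma> Q)) \<le> \<nu> (?T i k)" if "k \<le> i" "i \<le> n" for i k
  proof (cases "k \<le> j")
    case True
    have "nmul i (\<gamma> R - \<gamma> Q) \<le> nmul n (\<gamma> R - \<gamma> Q)" using Q(3) that by (intro nmul_mono_left) auto
    then show ?thesis
      using Fin_le_mono[OF _ pq(1)[of i "i - k" "j - k" "i choose k", unfolded weight[OF that(1) True]]] True
      by simp
  qed simp
  then have "Fin (?c - nmul j (\<gamma> Q)) \<le> \<nu> (qcoeff Q f j)"
    unfolding exp by (intro v_sum_ge) auto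
  then show "Fin ?c \<le> \<nu> (qcoeff Q f j * Q ^ j)" using QQ_value[OF Q(1)] by (simp add: v_mult_power_le_iff)
qed

text \<open>Past \<open>Q\<close> all terms of positive index in the \<open>R\<close>-expansion
  exceed the value of \<open>f\<close>, which is then the value of the remainder.\<close>

lemma value_mod_of_nuQ_eq:
  assumes Q: "Q \<in> QQ" "R \<in> QQ" "\<gamma> Q < \<gamma> R" and eq: "nuQ \<nu> Q f = \<nu> f"
  shows "\<nu> (f mod R) = \<nu> f"
proof (cases "\<nu> f")
  case (Fin c)
  then have "Fin c \<le> \<nu> (qcoeff Q f i * Q ^ i)" for i using eq QQ_nuQ_le_iff[OF Q(1)] by (metis order_refl)
  note gt = qcoeff_value_mono(2)[OF Q this]
  have "f = (\<Sum>i\<le>degree f. qcoeff R f i * R ^ i)" using QQ_degree_pos[OF Q(2)] by (rule qexpansion) simp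
  also have "\<dots> = qcoeff R f 0 + (\<Sum>i\<in>{..degree f} - {0}. qcoeff R f i * R ^ i)"
    by (subst sum.remove[of _ 0]) auto
  finally have "f mod R = f + - (\<Sum>i\<in>{..degree f} - {0}. qcoeff R f i * R ^ i)"
    by (simp add: qcoeff_0_eq_mod algebra_simps)
  moreover have "Fin c < \<nu> (- (\<Sum>i\<in>{..degree f} - {0}. qcoeff R f i * R ^ i))"
    unfolding v_uminus by (intro v_sum_gt gt) auto
  ultimately show ?thesis using v_add_eq[of f] Fin by metis
next
  \<comment> \<open>All digits have infinite value; having degree below \<open>m\<close>, they
    vanish, and so does \<open>f\<close>.\<close>
  case Pinf
  then have z: "qcoeff Q f i = 0" for i
  proof -
    have "\<nu> (qcoeff Q f i * Q ^ i) = Pinf" using Pinf eq QQ_nuQ_le_iff[OF Q(1)] by (metis Pinf_le order_refl)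
    then have "\<nu> (qcoeff Q f i) = Pinf"
      using QQ_value[OF Q(1)] by (cases "\<nu> (qcoeff Q f i)") (auto simp: v_mult v_power)
    then show ?thesis using small_value degree_QQ_qcoeff Q(1) by (metis extended.distinct(1))
  qed
  have "f = (\<Sum>i\<le>degree f. qcoeff Q f i * Q ^ i)" using QQ_degree_pos[OF Q(1)] by (rule qexpansion) simp
  then have "f = 0" using z by simp
  then show ?thesis by simp
qed simp

end

subsection \<open>Vertically unbounded families\<close>

text \<open>Bernoulli's inequality for \<open>1 + 1 / b\<close>, cleared of denominators and taken
  at the exponent \<open>b * N\<close>.\<close>

lemma power_ratio_unbounded:
  fixes a b N :: nat
  assumes "0 < b" "b < a"
  shows "\<exists>n. Suc N * b ^ n \<le> a ^ n"
proof -
  have *: "b ^ n * (b + n) \<le> b * Suc b ^ n" for n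
  proof (induction n)
    case (Suc n)
    have "b ^ Suc n * (b + Suc n) \<le> b ^ n * (b + n) * Suc b" by (simp add: algebra_simps)
    also have "\<dots> \<le> b * Suc b ^ n * Suc b" using Suc by (rule mult_le_mono1)
    finally show ?case by (simp only: power_Suc2 mult.assoc)
  qed simp
  have "b * (Suc N * b ^ (b * N)) = b ^ (b * N) * (b + b * N)" by (simp add: algebra_simps)
  also have "\<dots> \<le> b * Suc b ^ (b * N)" by (rule *)
  finally have "Suc N * b ^ (b * N) \<le> Suc b ^ (b * N)" using assms(1) by (simp only: nat_mult_le_cancel1)
  also have "\<dots> \<le> a ^ (b * N)" using assms(2) by (intro power_mono) auto
  finally show ?thesis by blast
qed

context key_family
begin

text \<open>Seen from \<open>\<gamma> Q\<close>, the values of the family are cofinally closed under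
  multiples.\<close>

definition dilating :: "'k poly \<Rightarrow> bool" where
  "dilating Q \<longleftrightarrow> (\<forall>R\<in>QQ. \<forall>N. \<exists>S\<in>QQ. nmul N (\<gamma> R - \<gamma> Q) \<le> \<gamma> S - \<gamma> Q)"

text \<open>Failure of boundedness provides a base point \<open>x\<close> and one ratio
  \<open>a / b > 1\<close> by which distances from \<open>x\<close> can always be stretched.
  Iteration stretches them by \<open>(a / b) ^ n\<close>, beyond any given multiple.\<close>

lemma vert_unbounded_dilating:
  assumes "vert_unbounded \<nu> QQ"
  obtains Q where "Q \<in> QQ" "dilating Q"
proof -
  let ?L = "gammaL \<nu> QQ"
  obtain x a b where x: "x \<in> ?L" and ab: "0 < b" "b < a"
    and step: "\<And>y. y \<in> ?L \<Longrightarrow> \<exists>z\<in>?L. \<not> z - x < gdiv (nmul a (y - x)) b"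
    using assms by (auto simp: vert_unbounded_def vert_bounded_def)
  have step': "\<exists>z\<in>?L. nmul a (y - x) \<le> nmul b (z - x)" if y: "y \<in> ?L" for y
  proof -
    obtain z where z: "z \<in> ?L" "gdiv (nmul a (y - x)) b \<le> z - x" using step[OF y] by (auto simp: not_less)
    then show ?thesis using nmul_mono[OF z(2), of b] nmul_gdiv[OF divisible ab(1)] by auto
  qed
  have iter: "\<exists>z\<in>?L. nmul (a ^ n) (y - x) \<le> nmul (b ^ n) (z - x)" if y: "y \<in> ?L" for y n
  proof (induction n)
    case (Suc n)
    then obtain z where z: "z \<in> ?L" "nmul (a ^ n) (y - x) \<le> nmul (b ^ n) (z - x)" by blast
    obtain w where w: "w \<in> ?L" "nmul a (z - x) \<le> nmul b (w - x)" using step' z by blast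
    have "nmul (a ^ Suc n) (y - x) = nmul a (nmul (a ^ n) (y - x))" by (simp add: nmul_mult)
    also have "\<dots> \<le> nmul a (nmul (b ^ n) (z - x))" using z(2) by (rule nmul_mono)
    also have "\<dots> = nmul (b ^ n) (nmul a (z - x))" by (simp add: mult.commute flip: nmul_mult)
    also have "\<dots> \<le> nmul (b ^ n) (nmul b (w - x))" using w(2) by (rule nmul_mono)
    also have "\<dots> = nmul (b ^ Suc n) (w - x)" by (simp add: mult.commute flip: nmul_mult)
    finally show ?case using w by blast
  qed (use y in auto)
  obtain Q where Q: "Q \<in> QQ" "x \<le> \<gamma> Q" using x by (auto simp: gammaL_def)
  have "dilating Q"
    unfolding dilating_def
  proof (intro ballI allI)
    fix R N assume R: "R \<in> QQ"
    obtain y where y: "y \<in> ?L" "\<gamma> Q \<le> y" "\<gamma> R \<le> y"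
    proof -
      have "\<gamma> Q \<in> ?L" "\<gamma> R \<in> ?L" using Q(1) R QQ_value_Gam by (auto simp: gammaL_def)
      then show ?thesis using that by (metis linear order_refl)
    qed
    define u where "u = y - x"
    have u: "0 \<le> u" using y Q by (simp add: u_def)
    \<comment> \<open>The extra multiple in \<open>Suc N\<close> pays for moving the base point from
      \<open>x\<close> to \<open>\<gamma> Q\<close>.\<close>
    obtain n where n: "Suc N * b ^ n \<le> a ^ n" using power_ratio_unbounded[OF ab] by blast
    obtain z where z: "z \<in> ?L" "nmul (a ^ n) u \<le> nmul (b ^ n) (z - x)"
      using iter[OF y(1)] unfolding u_def by blast
    have "nmul (b ^ n) (nmul (Suc N) u) = nmul (Suc N * b ^ n) u"
      by (simp only: nmul_mult[symmetric] mult.commute)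
    also have "\<dots> \<le> nmul (a ^ n) u" using n u by (rule nmul_mono_left)
    also note z(2)
    finally have "nmul (Suc N) u \<le> z - x" using ab by (simp add: nmul_le_cancel del: nmul.simps)
    then have zu: "u + nmul N u \<le> z - x" by simp
    obtain S where S: "S \<in> QQ" "z \<le> \<gamma> S" using z by (auto simp: gammaL_def)
    have "\<gamma> R - \<gamma> Q \<le> u" unfolding u_def using y Q by (intro diff_mono) auto
    then have "nmul N (\<gamma> R - \<gamma> Q) \<le> nmul N u" by (rule nmul_mono)
    also have "\<dots> \<le> z - x - u" using zu by (simp add: algebra_simps)
    also have "\<dots> = z - y" by (simp add: u_def)
    also have "\<dots> \<le> \<gamma> S - \<gamma> Q" using S(2) y(2) by (rule diff_mono)
    finally show "\<exists>S\<in>QQ. nmul N (\<gamma> R - \<gamma> Q) \<le> \<gamma> S - \<gamma> Q" using S by blast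
  qed
  with Q that show ?thesis by blast
qed

text \<open>If \<open>\<gamma> R - \<gamma> Q0\<close> were below a multiple of
  \<open>\<gamma> S - \<gamma> Q\<close>, distances from \<open>Q0\<close> would be bounded by
  multiples of distances from \<open>Q\<close>, and \<open>Q0\<close> would inherit the dilating
  property.\<close>

lemma far_below:
  assumes Q0: "Q0 \<in> QQ" "\<not> dilating Q0" and Q: "Q \<in> QQ" "dilating Q"
    and R: "R \<in> QQ" "\<gamma> Q \<le> \<gamma> R" and S: "S \<in> QQ"
  shows "nmul n (\<gamma> S - \<gamma> Q) \<le> \<gamma> R - \<gamma> Q0"
proof (rule ccontr)
  assume "\<not> ?thesis"
  then have lt: "\<gamma> R - \<gamma> Q0 < nmul n (\<gamma> S - \<gamma> Q)" by simp
  have "dilating Q0"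
    unfolding dilating_def
  proof (intro ballI allI)
    fix T N assume T: "T \<in> QQ"
    obtain U where U: "U \<in> QQ" "\<gamma> S \<le> \<gamma> U" "\<gamma> T \<le> \<gamma> U" using QQ_greater2[OF S T] by (metis less_imp_le)
    obtain V where V: "V \<in> QQ" "nmul (N * Suc n) (\<gamma> U - \<gamma> Q) \<le> \<gamma> V - \<gamma> Q"
      using Q(2) U(1) unfolding dilating_def by blast
    have "\<gamma> Q - \<gamma> Q0 \<le> \<gamma> R - \<gamma> Q0" using R by simp
    also have "\<dots> \<le> nmul n (\<gamma> S - \<gamma> Q)" using lt by simp
    also have "\<dots> \<le> nmul n (\<gamma> U - \<gamma> Q)" using U by (intro nmul_mono) simp
    finally have le: "\<gamma> Q - \<gamma> Q0 \<le> nmul n (\<gamma> U - \<gamma> Q)" .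
    have "\<gamma> T - \<gamma> Q0 = (\<gamma> T - \<gamma> Q) + (\<gamma> Q - \<gamma> Q0)" by simp
    also have "\<dots> \<le> (\<gamma> U - \<gamma> Q) + nmul n (\<gamma> U - \<gamma> Q)" using U le by (intro add_mono) auto
    also have "\<dots> = nmul (Suc n) (\<gamma> U - \<gamma> Q)" by simp
    finally have "nmul N (\<gamma> T - \<gamma> Q0) \<le> nmul N (nmul (Suc n) (\<gamma> U - \<gamma> Q))" by (rule nmul_mono)
    also have "\<dots> \<le> \<gamma> V - \<gamma> Q" using V(2) by (simp only: nmul_mult)
    finally have NT: "nmul N (\<gamma> T - \<gamma> Q0) \<le> \<gamma> V - \<gamma> Q" .
    show "\<exists>S\<in>QQ. nmul N (\<gamma> T - \<gamma> Q0) \<le> \<gamma> S - \<gamma> Q0"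
    proof (cases "\<gamma> Q0 \<le> \<gamma> Q")
      case True
      then have "\<gamma> V - \<gamma> Q \<le> \<gamma> V - \<gamma> Q0" by simp
      then show ?thesis using NT V(1) by (meson order_trans)
    next
      case False
      have Q0U: "\<exists>U\<in>QQ. \<gamma> Q0 \<le> \<gamma> U \<and> \<gamma> T \<le> \<gamma> U"
        using QQ_greater2[OF Q0(1) T] by (metis less_imp_le)
      then obtain W where W: "W \<in> QQ" "\<gamma> Q0 \<le> \<gamma> W" "\<gamma> T \<le> \<gamma> W" by blast
      obtain V where V: "V \<in> QQ" "nmul (Suc N) (\<gamma> W - \<gamma> Q) \<le> \<gamma> V - \<gamma> Q"
        using Q(2) W(1) unfolding dilating_def by blast
      have "\<gamma> T - \<gamma> Q0 \<le> \<gamma> W - \<gamma> Q" using W False by (intro diff_mono) auto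
      then have "nmul N (\<gamma> T - \<gamma> Q0) + (\<gamma> Q0 - \<gamma> Q) \<le> nmul N (\<gamma> W - \<gamma> Q) + (\<gamma> W - \<gamma> Q)"
        using W by (intro add_mono nmul_mono) auto
      also have "\<dots> = nmul (Suc N) (\<gamma> W - \<gamma> Q)" by simp
      also note V(2)
      finally have "nmul N (\<gamma> T - \<gamma> Q0) \<le> \<gamma> V - \<gamma> Q0" by (simp add: algebra_simps)
      then show ?thesis using V(1) by blast
    qed
  qed
  then show False using Q0 by simp
qed

text \<open>Let \<open>b\<close> be the top index of the initial form of \<open>shift Q\<close>.
  Adding \<open>R - Q\<close> leaves the value of the coefficient at \<open>b\<close> unchanged;
  comparing it with the bound at the level of \<open>R\<close> gives the claim with
  \<open>s = b\<close>.\<close>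

lemma level_gap:
  assumes Q: "Q \<in> QQ" "R \<in> QQ" "\<gamma> Q < \<gamma> R"
  obtains s where "0 < s" "\<gamma> R - \<gamma> Q \<le> nmul s (level \<nu> R - level \<nu> Q)"
proof -
  obtain b where key: "abs_key Q (level \<nu> Q) (\<gamma> Q) b" using QQ_abs_key Q by blast
  obtain b' where key': "abs_key R (level \<nu> R) (\<gamma> R) b'" using QQ_abs_key Q by blast
  have b: "0 < b" "\<nu> (coeff (shift Q) b) = Fin (\<gamma> Q - nmul b (level \<nu> Q))"
    using key by (auto simp: abs_key_def gauss_top_def)
  have "gauss_init (level \<nu> Q) (\<gamma> Q) (shift (R - Q))"
    using value_QQ_diff(2)[OF Q] degree_QQ_diff[OF Q(2,1)] QQ_degree[OF Q(1)]
    by (intro abs_key_small[OF key]) auto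
  then have "Fin (\<gamma> Q - nmul b (level \<nu> Q)) < \<nu> (coeff (shift (R - Q)) b)"
    using b by (auto simp: gauss_init_def)
  then have "\<nu> (coeff (shift Q) b + coeff (shift (R - Q)) b) = Fin (\<gamma> Q - nmul b (level \<nu> Q))"
    using v_add_eq b(2) by metis
  then have "\<nu> (coeff (shift R) b) = Fin (\<gamma> Q - nmul b (level \<nu> Q))" by (simp add: shift_diff)
  moreover have "Fin (\<gamma> R - nmul b (level \<nu> R)) \<le> \<nu> (coeff (shift R) b)"
    using key' by (auto simp: abs_key_def gauss_top_def gauss_ge_def)
  ultimately have "\<gamma> R - \<gamma> Q \<le> nmul b (level \<nu> R - level \<nu> Q)"
    by (simp add: nmul_minus algebra_simps)
  then show ?thesis using that b by blast
qed

lemma deltaL_iff: "x \<in> deltaL \<nu> QQ F \<longleftrightarrow> x \<in> Gam \<nu> \<and> (\<exists>Q\<in>QQ. Fin x \<le> nuQ \<nu> Q F)"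
  by (simp add: deltaL_def)

lemma beta_value:
  assumes "Q \<in> QQ"
  shows "beta \<nu> Q F l = Pinf \<or> (\<exists>c\<in>Gam \<nu>. beta \<nu> Q F l = Fin c)"
  unfolding beta_def
  using small_value[OF _ degree_QQ_qcoeff[OF assms]] v_0 by metis

lemma nuQ_le_beta:
  assumes "Q \<in> QQ" "Fin c \<le> nuQ \<nu> Q F"
  shows "Fin (c - nmul l (\<gamma> Q)) \<le> beta \<nu> Q F l"
  using assms v_mult_power_le_iff[OF QQ_value[OF assms(1)]] by (simp add: beta_def QQ_nuQ_le_iff)

section \<open>Coefficient values when every element of \<open>QQ\<close> is dilating\<close>

text \<open>In the unbounded case \<open>b - nmul (i - j) (\<gamma> Q2)\<close> lies in
  \<open>calB\<close> at \<open>i\<close>. In the constant case the constant is bounded below by a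
  fixed element, whereas the required bound drops by a positive multiple of
  \<open>\<gamma> Q\<close>, which the dilating property makes large enough.\<close>

lemma higher_terms_large:
  assumes dil: "\<forall>Q\<in>QQ. dilating Q"
    and b: "b \<in> Gam \<nu>" "b \<le> b'" "Q2 \<in> QQ" "b' + nmul j (\<gamma> Q2) \<in> deltaL \<nu> QQ F"
    and ij: "j < i"
    and i: "(\<exists>c. ev \<nu> QQ (\<lambda>Q. beta \<nu> Q F i = c)) \<or>
      (\<forall>b\<in>calB \<nu> QQ F i. ev \<nu> QQ (\<lambda>Q. Fin b \<le> beta \<nu> Q F i))"
  shows "ev \<nu> QQ (\<lambda>Q. \<forall>R\<in>QQ. \<gamma> Q \<le> \<gamma> R \<longrightarrow> Fin (b - nmul (i - j) (\<gamma> Q)) \<le> beta \<nu> R F i)"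
  using i
proof
  assume "\<forall>b\<in>calB \<nu> QQ F i. ev \<nu> QQ (\<lambda>Q. Fin b \<le> beta \<nu> Q F i)"
  moreover have "b - nmul (i - j) (\<gamma> Q2) \<in> calB \<nu> QQ F i"
  proof -
    have G: "b - nmul (i - j) (\<gamma> Q2) \<in> Gam \<nu>" using b by (intro Gam_diff Gam_nmul QQ_value_Gam)
    have "b - nmul (i - j) (\<gamma> Q2) + nmul i (\<gamma> Q2) = b + nmul j (\<gamma> Q2)"
      using nmul_add[of j "i - j" "\<gamma> Q2"] ij by simp
    moreover have "b + nmul j (\<gamma> Q2) \<in> deltaL \<nu> QQ F"
    proof -
      obtain Q where "Q \<in> QQ" "Fin (b' + nmul j (\<gamma> Q2)) \<le> nuQ \<nu> Q F"
        using b(4) by (auto simp: deltaL_iff)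
      moreover from this(2) have "Fin (b + nmul j (\<gamma> Q2)) \<le> nuQ \<nu> Q F"
        by (rule Fin_le_mono[rotated]) (use b(2) in simp)
      moreover have "b + nmul j (\<gamma> Q2) \<in> Gam \<nu>" using b by (intro Gam_add Gam_nmul QQ_value_Gam)
      ultimately show ?thesis unfolding deltaL_iff by blast
    qed
    ultimately have "b - nmul (i - j) (\<gamma> Q2) + nmul i (\<gamma> Q2) \<in> deltaL \<nu> QQ F" by (simp only:)
    then show ?thesis using G b(3) unfolding calB_def by blast
  qed
  ultimately have "ev \<nu> QQ (\<lambda>Q. Fin (b - nmul (i - j) (\<gamma> Q2)) \<le> beta \<nu> Q F i)" by blast
  then obtain Q4 where Q4: "Q4 \<in> QQ"
    "\<And>R. R \<in> QQ \<Longrightarrow> \<gamma> Q4 \<le> \<gamma> R \<Longrightarrow> Fin (b - nmul (i - j) (\<gamma> Q2)) \<le> beta \<nu> R F i"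
    unfolding ev_iff by blast
  obtain S where S: "S \<in> QQ" "\<gamma> Q2 < \<gamma> S" "\<gamma> Q4 < \<gamma> S" using QQ_greater2[OF b(3) Q4(1)] by blast
  show ?thesis
    unfolding ev_iff
  proof (intro bexI[of _ S] ballI impI)
    fix Q R assume QR: "Q \<in> QQ" "\<gamma> S \<le> \<gamma> Q" "R \<in> QQ" "\<gamma> Q \<le> \<gamma> R"
    have "b - nmul (i - j) (\<gamma> Q) \<le> b - nmul (i - j) (\<gamma> Q2)"
      using S QR by (intro diff_left_mono nmul_mono) simp
    then show "Fin (b - nmul (i - j) (\<gamma> Q)) \<le> beta \<nu> R F i"
      by (rule Fin_le_mono) (use S QR in \<open>intro Q4(2); auto\<close>)
  qed (use S in simp)
next
  assume "\<exists>c. ev \<nu> QQ (\<lambda>Q. beta \<nu> Q F i = c)"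
  then obtain c Q4 where Q4: "Q4 \<in> QQ" "\<And>R. R \<in> QQ \<Longrightarrow> \<gamma> Q4 \<le> \<gamma> R \<Longrightarrow> beta \<nu> R F i = c"
    unfolding ev_iff by blast
  obtain Q3 where Q3: "Q3 \<in> QQ" "Fin (b' + nmul j (\<gamma> Q2)) \<le> nuQ \<nu> Q3 F"
    using b by (auto simp: deltaL_iff)
  obtain T where T: "T \<in> QQ" "\<gamma> Q3 < \<gamma> T" "\<gamma> Q4 < \<gamma> T" using QQ_greater2[OF Q3(1) Q4(1)] by blast
  obtain U where U: "U \<in> QQ" "\<gamma> T < \<gamma> U" "\<gamma> Q2 < \<gamma> U" using QQ_greater2[OF T(1) b(3)] by blast
  have "Fin (b' + nmul j (\<gamma> Q2)) \<le> nuQ \<nu> U F" using nuQ_mono[OF Q3(1) U(1) _ Q3(2)] T U by simp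
  from nuQ_le_beta[OF U(1) this, of i]
  have c: "Fin (b' + nmul j (\<gamma> Q2) - nmul i (\<gamma> U)) \<le> c" using Q4(2)[OF U(1)] T U by simp
  \<comment> \<open>Beyond \<open>V\<close> already one multiple of
    \<open>\<gamma> Q - \<gamma> Q2\<close> outweighs the loss
    \<open>nmul i (\<gamma> U - \<gamma> Q2)\<close>, and \<open>i - j \<ge> 1\<close>.\<close>
  obtain V where V: "V \<in> QQ" "nmul i (\<gamma> U - \<gamma> Q2) \<le> \<gamma> V - \<gamma> Q2"
    using dil b(3) U(1) unfolding dilating_def by blast
  obtain S where S: "S \<in> QQ" "\<gamma> V < \<gamma> S" "\<gamma> U < \<gamma> S" using QQ_greater2[OF V(1) U(1)] by blast
  show ?thesis
    unfolding ev_iff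
  proof (intro bexI[of _ S] ballI impI)
    fix Q R assume QR: "Q \<in> QQ" "\<gamma> S \<le> \<gamma> Q" "R \<in> QQ" "\<gamma> Q \<le> \<gamma> R"
    have "nmul i (\<gamma> U - \<gamma> Q2) \<le> \<gamma> V - \<gamma> Q2" by (rule V)
    also have "\<dots> \<le> \<gamma> Q - \<gamma> Q2" using S QR by simp
    also have "\<dots> = nmul 1 (\<gamma> Q - \<gamma> Q2)" by simp
    also have "\<dots> \<le> nmul (i - j) (\<gamma> Q - \<gamma> Q2)" using ij S QR U by (intro nmul_mono_left) auto
    finally have "nmul i (\<gamma> U) - nmul i (\<gamma> Q2) \<le> nmul (i - j) (\<gamma> Q) - nmul (i - j) (\<gamma> Q2)"
      by (simp only: nmul_minus)
    moreover have "nmul i (\<gamma> Q2) = nmul j (\<gamma> Q2) + nmul (i - j) (\<gamma> Q2)"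
      using nmul_add[of j "i - j" "\<gamma> Q2"] ij by simp
    ultimately have "nmul i (\<gamma> U) \<le> nmul (i - j) (\<gamma> Q) + nmul j (\<gamma> Q2)"
      by (simp add: algebra_simps)
    then have "b + nmul i (\<gamma> U) \<le> b' + (nmul (i - j) (\<gamma> Q) + nmul j (\<gamma> Q2))"
      using b(2) by (intro add_mono)
    then have "b - nmul (i - j) (\<gamma> Q) \<le> b' + nmul j (\<gamma> Q2) - nmul i (\<gamma> U)"
      by (simp add: algebra_simps)
    then have "Fin (b - nmul (i - j) (\<gamma> Q)) \<le> c" using c by (rule Fin_le_mono)
    moreover have "beta \<nu> R F i = c" using Q4(2)[OF QR(3)] QR S U T by simp
    ultimately show "Fin (b - nmul (i - j) (\<gamma> Q)) \<le> beta \<nu> R F i" by simp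
  qed (use S in simp)
qed

text \<open>Rewriting the \<open>R\<close>-expansion of \<open>F\<close> in powers of \<open>Q\<close>, the terms of index \<open>i < j\<close> do not reach the
  \<open>j\<close>-th coefficient for degree reasons, and those of index \<open>j\<close> change it by a quantity of larger
  value, so only the indices \<open>i > j\<close> matter.\<close>

lemma beta_eq_of_higher_terms:
  assumes Q: "Q \<in> QQ" "R \<in> QQ" "\<gamma> Q < \<gamma> R"
    and less: "beta \<nu> Q F j < Fin b"
    and high: "\<And>i. j < i \<Longrightarrow> i \<le> degree F \<Longrightarrow> Fin (b - nmul (i - j) (\<gamma> Q)) \<le> beta \<nu> R F i"
  shows "beta \<nu> R F j = beta \<nu> Q F j"
proof -
  define n where "n = degree F"
  define a where "a = R - Q"
  define E where "E = (\<lambda>i k. of_nat (i choose k) * qcoeff R F i * a ^ (i - k))"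
  define S where "S = (\<lambda>i. \<Sum>k\<le>i. if k \<le> j then qcoeff Q (E i k) (j - k) else 0)"
  have exp: "qcoeff Q F j = (\<Sum>i\<le>n. S i)"
    unfolding S_def E_def a_def using Q by (intro qcoeff_change_base) (auto simp: QQ_degree_pos n_def)
  have da: "degree a < m" and va: "Fin (\<gamma> Q) \<le> \<nu> a"
    using degree_QQ_diff[OF Q(2,1)] value_QQ_diff(2)[OF Q] by (auto simp: a_def)
  note dR = degree_QQ_qcoeff[OF Q(2)]
  have low: "S i = 0" if "i < j" for i
    unfolding S_def E_def using that product_qcoeff_eq_0[OF Q(1) dR da] by (intro sum.neutral) auto
  have jn: "j \<le> n"
  proof (rule ccontr)
    assume "\<not> j \<le> n"
    then have "qcoeff Q F j = 0" unfolding exp by (intro sum.neutral) (auto intro: low)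
    then show False using less by (simp add: beta_def)
  qed
  have "(\<Sum>i\<le>n. S i) = (\<Sum>i\<in>{j..n}. S i)" by (rule sum.mono_neutral_right) (auto intro: low)
  also have "\<dots> = S j + (\<Sum>i\<in>{j<..n}. S i)" using jn by (rule sum.head)
  finally have split: "qcoeff Q F j = S j + (\<Sum>i\<in>{j<..n}. S i)" using exp by simp
  have R2: "Fin b \<le> \<nu> (\<Sum>i\<in>{j<..n}. S i)"
  proof (rule v_sum_ge)
    fix i assume i: "i \<in> {j<..n}"
    show "Fin b \<le> \<nu> (S i)"
      unfolding S_def
    proof (rule v_sum_ge)
      fix k assume k: "k \<in> {..i}"
      show "Fin b \<le> \<nu> (if k \<le> j then qcoeff Q (E i k) (j - k) else 0)"
      proof (cases "k \<le> j")
        case True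
        have "Fin (b - nmul (i - j) (\<gamma> Q)) \<le> \<nu> (qcoeff R F i)"
          using high i by (auto simp: beta_def n_def)
        from product_qcoeff(1)[OF Q(1) dR da this va, of "i - k" "j - k" "i choose k"]
        have "Fin (b - nmul (i - j) (\<gamma> Q) + nmul (i - k) (\<gamma> Q) - nmul (j - k) (\<gamma> Q)) \<le>
          \<nu> (qcoeff Q (E i k) (j - k))" by (simp add: E_def)
        moreover have "nmul (i - k) (\<gamma> Q) = nmul (i - j) (\<gamma> Q) + nmul (j - k) (\<gamma> Q)"
          using nmul_add[of "i - j" "j - k" "\<gamma> Q"] i True by simp
        ultimately show ?thesis using True by simp
      qed simp
    qed
  qed
  have Sj: "S j = (\<Sum>k<j. qcoeff Q (E j k) (j - k)) + qcoeff R F j"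
  proof -
    have "S j = (\<Sum>k\<le>j. qcoeff Q (E j k) (j - k))" unfolding S_def by (intro sum.cong) auto
    also have "\<dots> = (\<Sum>k<j. qcoeff Q (E j k) (j - k)) + qcoeff Q (E j j) 0"
      by (simp add: lessThan_Suc_atMost[symmetric])
    also have "qcoeff Q (E j j) 0 = qcoeff R F j"
      using dR[of F j] QQ_degree[OF Q(1)] by (simp add: E_def qcoeff_0_eq_mod mod_poly_less)
    finally show ?thesis .
  qed
  \<comment> \<open>Otherwise only the higher indices contribute, and their values are at least
    \<open>b\<close>.\<close>
  have neq: "qcoeff R F j \<noteq> 0"
  proof
    assume "qcoeff R F j = 0"
    then have "S j = 0" unfolding Sj by (simp add: E_def)
    then show False using split R2 less by (simp add: beta_def)
  qed
  obtain e where e: "\<nu> (qcoeff R F j) = Fin e" using small_value[OF neq dR] by blast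
  have "Fin e < \<nu> (qcoeff Q (E j k) (j - k))" if "k < j" for k
    using product_qcoeff(2)[OF Q(1) dR da eq_refl[OF e[symmetric]] va, of "j - k" "j - k" "j choose k"] that
    by (simp add: E_def)
  then have "Fin e < \<nu> (\<Sum>k<j. qcoeff Q (E j k) (j - k))" by (intro v_sum_gt) auto
  then have vS: "\<nu> (S j) = Fin e"
    unfolding Sj using v_add_eq[of "qcoeff R F j" "\<Sum>k<j. qcoeff Q (E j k) (j - k)"] e
    by (simp only: add.commute)
  have "e < b"
  proof (rule ccontr)
    assume "\<not> e < b"
    then have "Fin b \<le> \<nu> (S j)" using vS by simp
    then have "Fin b \<le> \<nu> (qcoeff Q F j)" unfolding split using R2 by (rule v_add_ge)
    then show False using less by (simp add: beta_def)
  qed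
  then have "\<nu> (S j) < \<nu> (\<Sum>i\<in>{j<..n}. S i)" using vS R2 by (simp add: Fin_less_le_mono)
  then have "\<nu> (qcoeff Q F j) = Fin e" unfolding split using v_add_eq vS by metis
  then show ?thesis using e by (simp add: beta_def)
qed

text \<open>If some \<open>b\<close> in \<open>calB\<close> is undercut arbitrarily far out, start
  at such an \<open>R\<close> past which all higher coefficients are large: from there on the
  \<open>j\<close>-th value no longer changes.\<close>

lemma dilating_dichotomy:
  assumes dil: "\<forall>Q\<in>QQ. dilating Q"
  shows "(\<exists>c. ev \<nu> QQ (\<lambda>Q. beta \<nu> Q F j = c)) \<or>
    (\<forall>b\<in>calB \<nu> QQ F j. ev \<nu> QQ (\<lambda>Q. Fin b \<le> beta \<nu> Q F j))"
proof (induction "Suc (degree F) - j" arbitrary: j rule: less_induct)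
  case less
  show ?case
  proof (rule disjCI)
    assume "\<not> (\<forall>b\<in>calB \<nu> QQ F j. ev \<nu> QQ (\<lambda>Q. Fin b \<le> beta \<nu> Q F j))"
    then obtain b b' Q2 where b: "b \<in> Gam \<nu>" "b \<le> b'" "Q2 \<in> QQ" "b' + nmul j (\<gamma> Q2) \<in> deltaL \<nu> QQ F"
      and nev: "\<not> ev \<nu> QQ (\<lambda>Q. Fin b \<le> beta \<nu> Q F j)"
      unfolding calB_def by auto
    have "ev \<nu> QQ (\<lambda>Q. \<forall>i\<in>{j<..degree F}. \<forall>R\<in>QQ. \<gamma> Q \<le> \<gamma> R \<longrightarrow>
        Fin (b - nmul (i - j) (\<gamma> Q)) \<le> beta \<nu> R F i)"
    proof (rule ev_ball)
      fix i assume "i \<in> {j<..degree F}"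
      then show "ev \<nu> QQ (\<lambda>Q. \<forall>R\<in>QQ. \<gamma> Q \<le> \<gamma> R \<longrightarrow> Fin (b - nmul (i - j) (\<gamma> Q)) \<le> beta \<nu> R F i)"
        by (intro higher_terms_large[OF dil b] less) auto
    qed simp
    then obtain Q where Q: "Q \<in> QQ" "\<And>R i S. R \<in> QQ \<Longrightarrow> \<gamma> Q \<le> \<gamma> R \<Longrightarrow> i \<in> {j<..degree F} \<Longrightarrow> S \<in> QQ \<Longrightarrow>
        \<gamma> R \<le> \<gamma> S \<Longrightarrow> Fin (b - nmul (i - j) (\<gamma> R)) \<le> beta \<nu> S F i"
      unfolding ev_iff by blast
    obtain R where R: "R \<in> QQ" "\<gamma> Q \<le> \<gamma> R" "beta \<nu> R F j < Fin b"
      using nev Q(1) unfolding ev_iff by (auto simp: not_le)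
    have "beta \<nu> S F j = beta \<nu> R F j" if S: "S \<in> QQ" "\<gamma> R \<le> \<gamma> S" for S
    proof (cases "\<gamma> R = \<gamma> S")
      case True
      then show ?thesis using QQ_eqI R S by metis
    next
      case False
      then show ?thesis using S R Q(2) by (intro beta_eq_of_higher_terms) auto
    qed
    then show "\<exists>c. ev \<nu> QQ (\<lambda>Q. beta \<nu> Q F j = c)" unfolding ev_iff using R(1) by blast
  qed
qed

section \<open>Coefficient values when some element of \<open>QQ\<close> is not dilating\<close>

lemma stable_smult:
  assumes "stable \<nu> QQ f" "c \<noteq> 0"
  shows "\<exists>g. ev \<nu> QQ (\<lambda>R. \<nu> (smult c f mod R) = g)"
proof -
  obtain Q where Q: "Q \<in> QQ" "nuQ \<nu> Q f = \<nu> f"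
    using assms(1) unfolding stable_def ev_iff by blast
  obtain S where S: "S \<in> QQ" "\<gamma> Q < \<gamma> S" using QQ_greater Q by blast
  have "\<nu> (smult c f mod R) = \<nu> [:c:] + \<nu> f" if R: "R \<in> QQ" "\<gamma> S \<le> \<gamma> R" for R
  proof -
    have "\<nu> (f mod R) = \<nu> f" using Q S R by (intro value_mod_of_nuQ_eq) auto
    then show ?thesis using v_mult[of "[:c:]" "f mod R"] by (simp add: mod_smult_left)
  qed
  then show ?thesis unfolding ev_iff using S by blast
qed

text \<open>By minimality of the degree of \<open>F\<close>, the monic multiple of \<open>G\<close>
  is stable, and residues of stable polynomials keep their value.\<close>

lemma value_mod_ultimately_constant:
  assumes F: "F \<in> KP_inf \<nu> QQ" and G: "degree G < degree F"
  shows "\<exists>g. ev \<nu> QQ (\<lambda>R. \<nu> (G mod R) = g)"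
proof (cases "G = 0")
  case True
  then show ?thesis using QQ_ne by (auto simp: ev_def)
next
  case False
  define H where "H = smult (inverse (lead_coeff G)) G"
  have "lead_coeff H = 1" "degree H < degree F" using False G by (auto simp: H_def)
  then have "stable \<nu> QQ H" using F unfolding KP_inf_def by (auto simp: not_le[symmetric])
  moreover have "G = smult (lead_coeff G) H" using False by (simp add: H_def)
  ultimately show ?thesis using stable_smult[of H "lead_coeff G"] False by simp
qed

text \<open>\<open>level_gap\<close> bounds \<open>\<gamma> R - \<gamma> Q0\<close> by
  \<open>s\<close> times the difference of levels, and \<open>far_below\<close> makes it larger than
  \<open>s * n\<close> times \<open>\<gamma> S - \<gamma> Q\<close>; then \<open>s\<close> cancels.
  The successor in \<open>Suc (s * n)\<close> gives strictness.\<close>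

lemma far_below_level:
  assumes Q0: "Q0 \<in> QQ" "\<not> dilating Q0" and Q: "Q \<in> QQ" "dilating Q"
    and R: "R \<in> QQ" "\<gamma> Q < \<gamma> R" and S: "S \<in> QQ" "\<gamma> Q < \<gamma> S"
  shows "nmul n (\<gamma> S - \<gamma> Q) < level \<nu> R - level \<nu> Q0"
proof -
  have pos: "0 < \<gamma> S - \<gamma> Q" using S by simp
  note far = far_below[OF Q0 Q R(1) less_imp_le[OF R(2)] S(1)]
  have "0 < \<gamma> R - \<gamma> Q0" using pos far[of "Suc 0"] by (simp only: nmul_one)
  then obtain s where s: "0 < s" "\<gamma> R - \<gamma> Q0 \<le> nmul s (level \<nu> R - level \<nu> Q0)"
    using level_gap[OF Q0(1) R(1)] by auto
  have "nmul s (nmul n (\<gamma> S - \<gamma> Q)) < (\<gamma> S - \<gamma> Q) + nmul s (nmul n (\<gamma> S - \<gamma> Q))" using pos by simp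
  also have "\<dots> = nmul (Suc (s * n)) (\<gamma> S - \<gamma> Q)" by (simp add: nmul_mult)
  also have "\<dots> \<le> \<gamma> R - \<gamma> Q0" by (rule far)
  also note s(2)
  finally show ?thesis using s(1) by (simp add: nmul_less_cancel)
qed

text \<open>The error terms all contain a carry in a product of polynomials of degree less than \<open>m\<close>, and
  each carry gains the difference of the levels of \<open>R\<close> and \<open>Q0\<close>.\<close>

lemma qcoeff_approx_hasse:
  assumes Q: "Q \<in> QQ" "R \<in> QQ" "\<gamma> Q < \<gamma> R" and Q0: "Q0 \<in> QQ" "level \<nu> Q0 \<le> level \<nu> R"
    and y: "Fin y \<le> nuQ \<nu> Q F"
  shows "\<exists>err. qcoeff R F l =
      (\<Sum>i\<in>{l..degree F}. of_nat (i choose l) * qcoeff Q F i * Q ^ (i - l)) mod R + err \<and>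
    Fin (y + (level \<nu> R - level \<nu> Q0) - nmul l (\<gamma> R)) \<le> \<nu> err"
proof -
  define n where "n = degree F"
  define a where "a = Q - R"
  define E where "E = (\<lambda>i k. of_nat (i choose k) * qcoeff Q F i * a ^ (i - k))"
  let ?T = "\<lambda>i k. if k \<le> l then qcoeff R (E i k) (l - k) else 0"
  let ?e = "level \<nu> R - level \<nu> Q0"
  have exp: "qcoeff R F l = (\<Sum>i\<le>n. \<Sum>k\<le>i. ?T i k)"
    unfolding E_def a_def using Q by (intro qcoeff_change_base) (auto simp: QQ_degree_pos n_def)
  define err where "err = (\<Sum>i\<le>n. \<Sum>k\<in>{..i} - {l}. ?T i k)"
  have da: "degree a < m" and va: "Fin (\<gamma> Q) \<le> \<nu> a"
    using degree_QQ_diff[OF Q(1,2)] value_QQ_diff(1)[OF Q] by (auto simp: a_def)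
  note dQ = degree_QQ_qcoeff[OF Q(1)]
  have vQ: "Fin (y - nmul i (\<gamma> Q)) \<le> \<nu> (qcoeff Q F i)" for i
    using nuQ_le_beta[OF Q(1) y] by (simp add: beta_def)
  have main: "(\<Sum>k\<le>i. ?T i k) = (if l \<le> i then E i l mod R else 0) + (\<Sum>k\<in>{..i} - {l}. ?T i k)" for i
  proof (cases "l \<le> i")
    case True
    then have "(\<Sum>k\<le>i. ?T i k) = ?T i l + (\<Sum>k\<in>{..i} - {l}. ?T i k)" by (intro sum.remove) auto
    then show ?thesis using True by (simp add: qcoeff_0_eq_mod)
  qed simp
  \<comment> \<open>Modulo \<open>R\<close> the difference \<open>a\<close> is \<open>Q\<close>, so
    the terms with \<open>k = l\<close> add up to the formal \<open>l\<close>-th Hasse derivative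
    with respect to \<open>Q\<close>.\<close>
  have E_mod: "E i l mod R = (of_nat (i choose l) * qcoeff Q F i * Q ^ (i - l)) mod R" for i
  proof -
    have "a mod R = Q mod R" by (simp add: a_def)
    then have "a ^ (i - l) mod R = Q ^ (i - l) mod R" by (metis power_mod)
    then show ?thesis unfolding E_def by (metis mod_mult_right_eq)
  qed
  have "qcoeff R F l = (\<Sum>i\<le>n. if l \<le> i then E i l mod R else 0) + err"
    unfolding exp main err_def by (simp add: sum.distrib)
  also have "(\<Sum>i\<le>n. if l \<le> i then E i l mod R else 0) = (\<Sum>i\<in>{l..n}. E i l mod R)"
    by (rule sum.mono_neutral_cong_right) auto
  also have "\<dots> = (\<Sum>i\<in>{l..n}. of_nat (i choose l) * qcoeff Q F i * Q ^ (i - l)) mod R"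
    using qcoeff_sum[of R "\<lambda>i. of_nat (i choose l) * qcoeff Q F i * Q ^ (i - l)" "{l..n}" 0]
    by (simp add: E_mod qcoeff_0_eq_mod)
  finally have eq: "qcoeff R F l =
    (\<Sum>i\<in>{l..n}. of_nat (i choose l) * qcoeff Q F i * Q ^ (i - l)) mod R + err" .
  obtain b where key: "abs_key R (level \<nu> R) (\<gamma> R) b" using QQ_abs_key Q by blast
  obtain b0 where key0: "abs_key Q0 (level \<nu> Q0) (\<gamma> Q0) b0" using QQ_abs_key Q0 by blast
  have "Fin (y + ?e - nmul l (\<gamma> R)) \<le> \<nu> err"
    unfolding err_def
  proof (intro v_sum_ge)
    fix i k assume "i \<in> {..n}" and k: "k \<in> {..i} - {l}"
    show "Fin (y + ?e - nmul l (\<gamma> R)) \<le> \<nu> (?T i k)"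
    proof (cases "k < l")
      case True
      let ?c = "y - nmul i (\<gamma> Q) + nmul (i - k) (\<gamma> Q)"
      \<comment> \<open>For \<open>k < l\<close> the digit has positive index \<open>l - k\<close>,
        so it is a carry and gains the level difference.\<close>
      have "Fin (?c + ?e) \<le> \<nu> (qcoeff R (E i k) (l - k) * R ^ (l - k))"
      proof (rule qcoeff_gap[OF key key0])
        show "gauss_init (level \<nu> R) ?c (shift (E i k))"
          unfolding E_def by (rule product_gauss_init[OF Q(2) dQ da vQ va])
        have "gauss_init (level \<nu> Q0) ?c (shift (E i k))"
          unfolding E_def by (rule product_gauss_init[OF Q0(1) dQ da vQ va])
        then show "gauss_ge (level \<nu> Q0) ?c (shift (E i k))" by (simp add: gauss_init_def)
      qed (use Q Q0 True QQ_degree in auto)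
      then have "Fin (?c + ?e - nmul (l - k) (\<gamma> R)) \<le> \<nu> (?T i k)"
        using QQ_value[OF Q(2)] True by (simp add: v_mult_power_le_iff)
      moreover have "y + ?e - nmul l (\<gamma> R) \<le> ?c + ?e - nmul (l - k) (\<gamma> R)"
      proof -
        have "?c + ?e - nmul (l - k) (\<gamma> R) = y + ?e - nmul l (\<gamma> R) + nmul k (\<gamma> R - \<gamma> Q)"
          using nmul_add[of k "i - k" "\<gamma> Q"] nmul_add[of k "l - k" "\<gamma> R"] True k
          by (simp add: nmul_minus algebra_simps)
        moreover have "0 \<le> nmul k (\<gamma> R - \<gamma> Q)" using Q(3) by (intro nmul_nonneg) simp
        ultimately show ?thesis by simp
      qed
      ultimately show ?thesis by (rule Fin_le_mono[rotated])
    qed (use k in auto)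
  qed
  then show ?thesis using eq unfolding n_def by blast
qed

lemma nuQ_finite:
  assumes "Q \<in> QQ" "F \<noteq> 0"
  shows "\<exists>y. nuQ \<nu> Q F = Fin y"
proof -
  obtain i where "qcoeff Q F i \<noteq> 0"
  proof (rule ccontr)
    assume "\<not> thesis"
    then have "\<And>i. qcoeff Q F i = 0" using that by blast
    then show False
      using qexpansion[OF QQ_degree_pos[OF assms(1)] order_refl, of F] assms(2) by simp
  qed
  then obtain c where "\<nu> (qcoeff Q F i) = Fin c"
    using small_value degree_QQ_qcoeff[OF assms(1)] by metis
  then have "\<nu> (qcoeff Q F i * Q ^ i) = Fin (c + nmul i (\<gamma> Q))"
    using QQ_value[OF assms(1)] by (simp add: v_mult v_power)
  moreover have "nuQ \<nu> Q F \<le> \<nu> (qcoeff Q F i * Q ^ i)"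
    using QQ_nuQ_le_iff[OF assms(1), of "nuQ \<nu> Q F"] by blast
  moreover have "nuQ \<nu> Q F \<noteq> Minf"
  proof
    have "{\<nu> (qcoeff Q F i * Q ^ i) | i. i \<le> degree F} \<noteq> {}" by auto
    then have "nuQ \<nu> Q F \<in> {\<nu> (qcoeff Q F i * Q ^ i) | i. i \<le> degree F}"
      unfolding nuQ_def by (intro Min_in) auto
    moreover assume "nuQ \<nu> Q F = Minf"
    ultimately have "Minf \<in> {\<nu> (qcoeff Q F i * Q ^ i) | i. i \<le> degree F}" by (simp only:)
    then obtain i where "Minf = \<nu> (qcoeff Q F i * Q ^ i)" by blast
    then show False using v_not_Minf by metis
  qed
  ultimately show ?thesis by (cases "nuQ \<nu> Q F") auto
qed

text \<open>Membership in \<open>Bset\<close> only says that being above the cut fails cofinally.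
  Since the finite values lie in \<open>Gam \<nu>\<close>, each failure is a finite value inside
  \<open>deltaL\<close>.\<close>

lemma not_above_in_deltaL:
  assumes "l \<in> Bset \<nu> QQ m F" "Q \<in> QQ"
  obtains R c where "R \<in> QQ" "\<gamma> Q \<le> \<gamma> R" "beta \<nu> R F l = Fin c" "c \<in> Gam \<nu>"
    "c + nmul l (\<gamma> R) \<in> deltaL \<nu> QQ F"
proof -
  have "\<not> ev \<nu> QQ (\<lambda>Q. above \<nu> QQ F (beta \<nu> Q F l + Fin (nmul l (\<gamma> Q))))"
    using assms(1) by (auto simp: Bset_def Jset_def)
  then obtain R where R: "R \<in> QQ" "\<gamma> Q \<le> \<gamma> R" "\<not> above \<nu> QQ F (beta \<nu> R F l + Fin (nmul l (\<gamma> R)))"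
    unfolding ev_iff using assms(2) by blast
  then obtain c where c: "beta \<nu> R F l = Fin c" "c \<in> Gam \<nu>"
    using beta_value[OF R(1), of F l] by (auto simp: above_def)
  moreover have "c + nmul l (\<gamma> R) \<in> Gam \<nu>" using c R by (intro Gam_add Gam_nmul QQ_value_Gam)
  ultimately show ?thesis using that R by (auto simp: above_def)
qed

text \<open>The residues of the formal derivative \<open>G\<close> have ultimately constant value.
  As \<open>l\<close> lies in \<open>Bset\<close>, some far \<open>R0\<close> has a coefficient
  value \<open>b\<close> that the error terms exceed from \<open>R0\<close> on, so \<open>b\<close>
  is that constant.\<close>

lemma ultimately_constant_of_not_dilating:
  assumes F: "F \<in> KP_inf \<nu> QQ" and l: "l \<in> Bset \<nu> QQ m F" "0 < l"
    and Q0: "Q0 \<in> QQ" "\<not> dilating Q0" and Q: "Q \<in> QQ" "dilating Q"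
  shows "\<exists>c. ev \<nu> QQ (\<lambda>R. beta \<nu> R F l = c)"
proof -
  define n where "n = degree F"
  define G where "G = (\<Sum>i\<in>{l..degree F}. of_nat (i choose l) * qcoeff Q F i * Q ^ (i - l))"
  have "F \<noteq> 0" using F by (auto simp: KP_inf_def)
  then obtain y where y: "nuQ \<nu> Q F = Fin y" using nuQ_finite Q by blast
  have "l \<le> n div m" using l by (auto simp: Bset_def n_def)
  then have n0: "0 < n" using l(2) by (cases "n = 0") auto
  have "degree G < n"
    unfolding G_def
  proof (rule degree_sum_less)
    fix i assume i: "i \<in> {l..degree F}"
    show "degree (of_nat (i choose l) * qcoeff Q F i * Q ^ (i - l)) < n"
    proof (cases "qcoeff Q F i = 0")
      case False
      have Qn: "Q \<noteq> 0" using QQ_degree_pos[OF Q(1)] by auto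
      have "degree (qcoeff Q F i * Q ^ i) \<le> n"
        using degree_qcoeff_mult_power_le[OF _ False] QQ_degree_pos Q by (auto simp: n_def)
      then have "degree (qcoeff Q F i) + i * m \<le> n"
        using False Qn QQ_degree Q by (simp add: degree_mult_eq degree_power_eq)
      moreover have "(i - l) * m < i * m" using i l m by simp
      moreover have "degree (of_nat (i choose l) * qcoeff Q F i * Q ^ (i - l)) \<le>
          degree (qcoeff Q F i) + (i - l) * m"
        using degree_mult_le[of "of_nat (i choose l) * qcoeff Q F i" "Q ^ (i - l)"]
          degree_mult_le[of "of_nat (i choose l)" "qcoeff Q F i"] Qn QQ_degree[OF Q(1)]
        by (simp add: degree_power_eq)
      ultimately show ?thesis by linarith
    qed (use n0 in simp)
  qed (rule n0)
  then obtain g Q1 where Q1: "Q1 \<in> QQ" "\<And>R. R \<in> QQ \<Longrightarrow> \<gamma> Q1 \<le> \<gamma> R \<Longrightarrow> \<nu> (G mod R) = g"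
    using value_mod_ultimately_constant[OF F, of G] unfolding ev_iff n_def by blast
  obtain Q2 where Q2: "Q2 \<in> QQ" "\<gamma> Q < \<gamma> Q2" "\<gamma> Q1 < \<gamma> Q2" using QQ_greater2[OF Q(1) Q1(1)] by blast
  obtain R0 b where R0: "R0 \<in> QQ" "\<gamma> Q2 \<le> \<gamma> R0" "beta \<nu> R0 F l = Fin b"
    "b + nmul l (\<gamma> R0) \<in> deltaL \<nu> QQ F" using not_above_in_deltaL[OF l(1) Q2(1)] by metis
  then obtain Q3 where Q3: "Q3 \<in> QQ" "Fin (b + nmul l (\<gamma> R0)) \<le> nuQ \<nu> Q3 F" by (auto simp: deltaL_iff)
  obtain T where T: "T \<in> QQ" "\<gamma> Q3 < \<gamma> T" "\<gamma> Q < \<gamma> T" using QQ_greater2[OF Q3(1) Q(1)] by blast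
  have "Fin (b + nmul l (\<gamma> R0)) \<le> nuQ \<nu> T F" using nuQ_mono[OF Q3(1) T(1) _ Q3(2)] T by simp
  \<comment> \<open>This bounds \<open>b\<close> by \<open>y\<close> up to multiples of differences
    of values in the family, all negligible against the level gap.\<close>
  then have bT: "b + nmul l (\<gamma> R0) \<le> y + nmul n (\<gamma> T - \<gamma> Q)"
    using nuQ_growth[OF Q(1) T(1) T(3), of F n] y by (auto simp: n_def algebra_simps)
  have approx: "\<exists>err. qcoeff R F l = G mod R + err \<and> Fin b < \<nu> err"
    if R: "R \<in> QQ" "\<gamma> R0 \<le> \<gamma> R" for R
  proof -
    have QR: "\<gamma> Q < \<gamma> R" using Q2 R0 R by auto
    obtain M where M: "M \<in> QQ" "\<gamma> T < \<gamma> M" "\<gamma> R < \<gamma> M" using QQ_greater2[OF T(1) R(1)] by blast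
    have QM: "\<gamma> Q < \<gamma> M" using M T by simp
    note gap = far_below_level[OF Q0 Q R(1) QR M(1) QM]
    have lev: "level \<nu> Q0 \<le> level \<nu> R" using gap[of 0] by simp
    obtain err where err: "qcoeff R F l = G mod R + err"
      "Fin (y + (level \<nu> R - level \<nu> Q0) - nmul l (\<gamma> R)) \<le> \<nu> err"
      using qcoeff_approx_hasse[OF Q(1) R(1) QR Q0(1) lev, of y F l] y unfolding G_def by auto
    have "b + nmul l (\<gamma> R) = (b + nmul l (\<gamma> R0)) + nmul l (\<gamma> R - \<gamma> R0)" by (simp add: nmul_minus)
    also have "\<dots> \<le> (y + nmul n (\<gamma> T - \<gamma> Q)) + nmul l (\<gamma> M - \<gamma> Q)"
      using M R0 Q2 by (intro add_mono[OF bT] nmul_mono diff_mono) auto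
    also have "\<dots> \<le> (y + nmul n (\<gamma> M - \<gamma> Q)) + nmul l (\<gamma> M - \<gamma> Q)"
      using M by (intro add_mono nmul_mono diff_mono) auto
    also have "\<dots> = y + nmul (n + l) (\<gamma> M - \<gamma> Q)" by (simp add: nmul_add add.assoc)
    also have "\<dots> < y + (level \<nu> R - level \<nu> Q0)" using gap by simp
    finally have "b < y + (level \<nu> R - level \<nu> Q0) - nmul l (\<gamma> R)" by (simp add: algebra_simps)
    then have "Fin b < \<nu> err" using err(2) by (rule Fin_less_le_mono)
    then show ?thesis using err(1) by blast
  qed
  obtain err where err: "qcoeff R0 F l = G mod R0 + err" "Fin b < \<nu> err"
    using approx[OF R0(1)] by blast
  then have "G mod R0 = qcoeff R0 F l + - err" by simp
  then have "\<nu> (G mod R0) = Fin b"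
    using v_add_eq[of "qcoeff R0 F l" "- err"] R0(3) err(2) by (simp add: beta_def)
  then have g: "g = Fin b" using Q1(2)[OF R0(1)] Q2 R0 by simp
  have "beta \<nu> R F l = Fin b" if R: "R \<in> QQ" "\<gamma> R0 \<le> \<gamma> R" for R
  proof -
    obtain err where err: "qcoeff R F l = G mod R + err" "Fin b < \<nu> err" using approx R by blast
    moreover have "\<nu> (G mod R) = Fin b" using Q1(2)[OF R(1)] Q2 R0 R g by simp
    ultimately show ?thesis using v_add_eq[of "G mod R" err] by (simp add: beta_def)
  qed
  then show ?thesis unfolding ev_iff using R0(1) by blast
qed

section \<open>The zeroth coefficient and disjointness\<close>

text \<open>At index \<open>0\<close> the elements of \<open>calB\<close> are below some
  \<open>\<nu>_Q(F)\<close>, and the zeroth coefficient has at least that value from then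
  on.\<close>

lemma zero_in_Bunb:
  assumes "0 \<in> Bset \<nu> QQ m F" shows "0 \<in> Bunb \<nu> QQ m F"
proof -
  have "ev \<nu> QQ (\<lambda>Q. Fin b \<le> beta \<nu> Q F 0)" if b: "b \<in> calB \<nu> QQ F 0" for b
  proof -
    obtain b' Q where Q: "b \<le> b'" "Q \<in> QQ" "Fin b' \<le> nuQ \<nu> Q F"
      using b by (auto simp: calB_def deltaL_iff)
    have "Fin b \<le> beta \<nu> R F 0" if "R \<in> QQ" "\<gamma> Q \<le> \<gamma> R" for R
      by (rule Fin_le_mono[OF Q(1)]) (use nuQ_le_beta[OF that(1) nuQ_mono[OF Q(2) that Q(3)], of 0] in simp)
    then show ?thesis unfolding ev_iff using Q by blast
  qed
  then show ?thesis using assms by (simp add: Bunb_def)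
qed

lemma Bct_Bunb_disjoint:
  assumes F: "F \<in> KP_inf \<nu> QQ"
  shows "Bct \<nu> QQ m F \<inter> Bunb \<nu> QQ m F = {}"
proof (rule ccontr)
  assume "Bct \<nu> QQ m F \<inter> Bunb \<nu> QQ m F \<noteq> {}"
  then obtain l c where l: "l \<in> Bset \<nu> QQ m F" and ct: "ev \<nu> QQ (\<lambda>Q. beta \<nu> Q F l = c)"
    and unb: "\<And>b. b \<in> calB \<nu> QQ F l \<Longrightarrow> ev \<nu> QQ (\<lambda>Q. Fin b \<le> beta \<nu> Q F l)"
    by (auto simp: Bct_def Bunb_def)
  obtain Q1 where Q1: "Q1 \<in> QQ" "\<And>R. R \<in> QQ \<Longrightarrow> \<gamma> Q1 \<le> \<gamma> R \<Longrightarrow> beta \<nu> R F l = c"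
    using ct unfolding ev_iff by blast
  have bound: "Fin b \<le> c" if "b \<in> calB \<nu> QQ F l" for b
    using ev_conj[OF unb[OF that] ct] unfolding ev_iff by auto
  obtain R d where R: "R \<in> QQ" "\<gamma> Q1 \<le> \<gamma> R" "beta \<nu> R F l = Fin d" "d \<in> Gam \<nu>"
    "d + nmul l (\<gamma> R) \<in> deltaL \<nu> QQ F" using not_above_in_deltaL[OF l Q1(1)] by metis
  have c: "c = Fin d" using Q1(2) R by simp
  show False
  proof (cases "l = 0")
    case False
    obtain R' where R': "R' \<in> QQ" "\<gamma> R < \<gamma> R'" using QQ_greater R by blast
    obtain S e where S: "S \<in> QQ" "\<gamma> R' \<le> \<gamma> S" "beta \<nu> S F l = Fin e"
      "e + nmul l (\<gamma> S) \<in> deltaL \<nu> QQ F" using not_above_in_deltaL[OF l R'(1)] by metis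
    have e: "e = d" using Q1(2)[OF S(1)] S R R' c by simp
    \<comment> \<open>With constant coefficient value \<open>d\<close>, the sum
      \<open>d + nmul l (\<gamma> S)\<close> is again in \<open>deltaL\<close>. Rewritten relative
      to \<open>R\<close> it puts an element larger than \<open>d\<close> into
      \<open>calB\<close>.\<close>
    define b where "b = d + nmul l (\<gamma> S - \<gamma> R)"
    have "b \<in> Gam \<nu>" unfolding b_def using R S by (intro Gam_add Gam_nmul Gam_diff QQ_value_Gam)
    moreover have "b + nmul l (\<gamma> R) \<in> deltaL \<nu> QQ F" using S(4) e by (simp add: b_def nmul_minus)
    ultimately have "b \<in> calB \<nu> QQ F l" using R(1) by (auto simp: calB_def)
    then have "b \<le> d" using bound c by simp
    moreover have "0 < nmul l (\<gamma> S - \<gamma> R)"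
      using nmul_strict_mono[of 0 "\<gamma> S - \<gamma> R" l] R' S False by simp
    ultimately show False by (simp add: b_def)
  next
    case True
    obtain Q3 where Q3: "Q3 \<in> QQ" "Fin d \<le> nuQ \<nu> Q3 F" using R(5) True by (auto simp: deltaL_iff)
    obtain T where T: "T \<in> QQ" "\<gamma> Q3 < \<gamma> T" "\<gamma> Q1 < \<gamma> T" using QQ_greater2[OF Q3(1) Q1(1)] by blast
    have "Fin d \<le> nuQ \<nu> T F" using nuQ_mono[OF Q3(1) T(1) _ Q3(2)] T by simp
    then have dT: "Fin d \<le> \<nu> (qcoeff T F i * T ^ i)" for i using QQ_nuQ_le_iff[OF T(1)] by blast
    \<comment> \<open>The zeroth term alone has the minimal value \<open>d\<close>, all others
      exceed it, so \<open>F\<close> would be stable.\<close>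
    have "nuQ \<nu> S F = \<nu> F" if S: "S \<in> QQ" "\<gamma> T < \<gamma> S" for S
    proof -
      note ge = qcoeff_value_mono[OF T(1) S dT]
      have S0: "\<nu> (qcoeff S F 0) = Fin d"
        using Q1(2)[OF S(1)] S T c True by (simp add: beta_def)
      have "F = (\<Sum>i\<le>degree F. qcoeff S F i * S ^ i)"
        using QQ_degree_pos[OF S(1)] by (rule qexpansion) simp
      also have "\<nu> \<dots> = Fin d" using S0 ge(2) by (intro v_sum_eq[of _ 0]) auto
      finally have "\<nu> F = Fin d" .
      moreover have "nuQ \<nu> S F = Fin d"
      proof (rule antisym)
        show "Fin d \<le> nuQ \<nu> S F" using ge(1) QQ_nuQ_le_iff[OF S(1)] by blast
        have "nuQ \<nu> S F \<le> \<nu> (qcoeff S F 0 * S ^ 0)"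
          using QQ_nuQ_le_iff[OF S(1), of "nuQ \<nu> S F"] by blast
        then show "nuQ \<nu> S F \<le> Fin d" using S0 by simp
      qed
      ultimately show ?thesis by simp
    qed
    moreover obtain T' where "T' \<in> QQ" "\<gamma> T < \<gamma> T'" using QQ_greater T by blast
    ultimately have "stable \<nu> QQ F" unfolding stable_def ev_iff by (intro bexI[of _ T']) auto
    then show False using F by (simp add: KP_inf_def)
  qed
qed

end

theorem mainTheorem14:
  fixes \<nu> :: "'k::field poly \<Rightarrow> 'g::linordered_ab_group_add extended"
    and m :: nat and QQ :: "'k poly set" and F :: "'k poly"
  assumes divisible: "\<forall>x::'g. \<forall>n>0. \<exists>y. nmul n y = x"
    and val: "poly_valuation \<nu>"
    and ws: "well_specified \<nu>"
    and m: "1 \<le> m"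
    and Psi_ne: "Psi \<nu> m \<noteq> {}"
    and Psi_nomax: "\<forall>Q\<in>Psi \<nu> m. \<exists>R\<in>Psi \<nu> m. \<nu> Q < \<nu> R"
    and QQ_sub: "QQ \<subseteq> Psi \<nu> m"
    and QQ_wo: "wo_by_value \<nu> QQ"
    and QQ_cof: "\<forall>R\<in>Psi \<nu> m. \<exists>Q\<in>QQ. \<nu> R \<le> \<nu> Q"
    and unstable_ex: "\<exists>f. \<not> stable \<nu> QQ f"
    and F: "F \<in> KP_inf \<nu> QQ"
    and vu: "vert_unbounded \<nu> QQ"
    and s_inf: "ev \<nu> QQ (\<lambda>Q. Iset \<nu> Q = {1})"
  shows "Bset \<nu> QQ m F = Bct \<nu> QQ m F \<union> Bunb \<nu> QQ m F
       \<and> Bct \<nu> QQ m F \<inter> Bunb \<nu> QQ m F = {}"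
proof -
  interpret key_family \<nu> m QQ
  proof unfold_locales
    show "QQ \<noteq> {}" using Psi_ne QQ_cof by blast
    show "inj_on \<nu> QQ" using QQ_wo by (simp add: wo_by_value_def)
    show "\<forall>Q\<in>QQ. \<exists>R\<in>QQ. \<nu> Q < \<nu> R" using Psi_nomax QQ_cof QQ_sub by (meson less_le_trans subsetD)
  qed (use val m QQ_sub divisible in auto)
  obtain Q where Q: "Q \<in> QQ" "dilating Q" using vert_unbounded_dilating[OF vu] by blast
  have "l \<in> Bct \<nu> QQ m F \<union> Bunb \<nu> QQ m F" if l: "l \<in> Bset \<nu> QQ m F" for l
  proof (cases "\<forall>Q\<in>QQ. dilating Q")
    case True
    then show ?thesis using dilating_dichotomy[OF True, of F l] l by (auto simp: Bct_def Bunb_def)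
  next
    case False
    then obtain Q0 where Q0: "Q0 \<in> QQ" "\<not> dilating Q0" by blast
    show ?thesis
    \<comment> \<open>At index \<open>0\<close> the formal derivative would be \<open>F\<close>
      itself, without a drop in degree, so this index is treated directly.\<close>
    proof (cases "l = 0")
      case True
      then show ?thesis using zero_in_Bunb l by simp
    next
      case False
      then show ?thesis
        using ultimately_constant_of_not_dilating[OF F l _ Q0 Q] l by (auto simp: Bct_def)
    qed
  qed
  moreover have "Bct \<nu> QQ m F \<union> Bunb \<nu> QQ m F \<subseteq> Bset \<nu> QQ m F" by (auto simp: Bct_def Bunb_def)
  ultimately show ?thesis using Bct_Bunb_disjoint[OF F] by blast
qed

end
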